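(* Let $D\subset\mathbb{C}^n$ be a domain. Then for every $z\in D$, $$s_D(z)\le h^c_D(z)\le h^k_D(z),$$ where $s_D$ is the squeezing function of $D$ and $h^c_D$, $h^k_D$ are the Fridman invariants of $D$ with respect to the Carathéodory pseudodistance $c_D$ and the Kobayashi pseudodistance $k_D$, respectively.
   Context: Notation: $\mathbb{B}_n\subset\mathbb{C}^n$ is the open unit ball, $\Delta\subset\mathbb{C}$ is the open unit disc, and $\mathcal{O}(X,Y)$ is the set of holomorphic maps from $X$ to $Y$. Squeezing function: for $z\in D$, $$s_D(z)=\sup\{r>0 : r\mathbb{B}_n\subset f(D),\ f\in\mathcal{O}(D,\mathbb{B}_n),\ f(z)=0,\ f \text{ injective}\},$$ with $s_D=0$ if $D$ is not biholomorphic to a bounded domain. Carathéodory pseudodistance: $c_D(z,w)=\sup\{\tanh^{-1}|\lambda| : f\in\mathcal{O}(D,\Delta),\ f(z)=0,\ f(w)=\lambda\}$. Lempert function: $l_D(z,w)=\inf\{\tanh^{-1}|\lambda| : f\in\mathcal{O}(\Delta,D),\ f(0)=z,\ f(\lambda)=w\}$ (with $\inf\emptyset=\infty$). The Kobayashi pseudodistance $k_D$ is the largest pseudodistance on $D$ not exceeding $l_D$. Fridman invariants: for $d\in\{c,k\}$ and $z\in D$, $$h^d_D(z)=\sup\{\tanh r : r>0,\ B^d_D(z,r)\subset f(\mathbb{B}_n),\ f\in\mathcal{O}(\mathbb{B}_n,D),\ f\text{ injective}\},$$ where $B^d_D(z,r)=\{w\in D: d_D(z,w)<r\}$; the value $h^d_D(z)=0$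 is allowed (the supremum of the empty set is taken to be $0$). *)

theory Defs
  imports "HOL-Analysis.Analysis"
begin

text \<open>
  A map between complex vector spaces is holomorphic on an open set if its total derivative
  exists at every point and is complex linear there. The source and target range over
  \<open>complex\<close> and \<open>complex ^ 'n\<close>, whose complex scalar multiplications \<open>(*)\<close> and \<open>(*s)\<close> do not
  share a name, so the scalings are parameters. Because of \<open>at z\<close>, \<open>X\<close> is meant to be open;
  the values of \<open>f\<close> outside \<open>X\<close> are then irrelevant.
\<close>

definition hol_maps ::
  "(complex \<Rightarrow> 'a \<Rightarrow> 'a) \<Rightarrow> (complex \<Rightarrow> 'b \<Rightarrow> 'b) \<Rightarrow>
    'a::real_normed_vector set \<Rightarrow> 'b::real_normed_vector set \<Rightarrow> ('a \<Rightarrow> 'b) set"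
  where "hol_maps sa sb X Y =
    {f. f ` X \<subseteq> Y \<and>
        (\<forall>z\<in>X. \<exists>f'. (f has_derivative f') (at z) \<and> Vector_Spaces.linear sa sb f')}"

lemma hol_maps_complex_iff:
  assumes "open X"
  shows "f \<in> hol_maps (*) (*) X Y \<longleftrightarrow> f holomorphic_on X \<and> f ` X \<subseteq> Y"
proof -
  have vs: "vector_space ((*) :: complex \<Rightarrow> complex \<Rightarrow> complex)"
    by (rule vector_space_over_itself.vector_space_axioms)
  have *: "(\<exists>f'. (f has_derivative f') (at z) \<and> Vector_Spaces.linear (*) (*) f')
      \<longleftrightarrow> f field_differentiable (at z)" for z
  proof
    assume "\<exists>f'. (f has_derivative f') (at z) \<and> Vector_Spaces.linear (*) (*) f'"
    then obtain f' where d: "(f has_derivative f') (at z)" and l: "Vector_Spaces.linear (*) (*) f'"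
      by blast
    define c where "c = f' 1"
    have "\<forall>r x. f' (r * x) = r * f' x"
      using l unfolding Vector_Spaces.linear_iff by blast
    then have "f' (v * 1) = v * c" for v
      unfolding c_def by (elim allE)
    then have "f' v = c * v" for v
      by (simp add: mult.commute)
    then have "f' = (*) c" by (rule ext)
    with d have "(f has_field_derivative c) (at z)"
      by (simp add: has_field_derivative_def)
    then show "f field_differentiable (at z)"
      by (auto simp: field_differentiable_def)
  next
    assume "f field_differentiable (at z)"
    then obtain c where "(f has_derivative (*) c) (at z)"
      by (auto simp: field_differentiable_def has_field_derivative_def)
    moreover have "Vector_Spaces.linear (*) (*) ((*) c)"
      using vs unfolding Vector_Spaces.linear_iff by (simp add: algebra_simps)
    ultimately show "\<exists>f'. (f has_derivative f') (at z) \<and> Vector_Spaces.linear (*) (*) f'"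
      by blast
  qed
  have "f holomorphic_on X \<longleftrightarrow> (\<forall>z\<in>X. f field_differentiable (at z))"
    unfolding holomorphic_on_def by (simp add: at_within_open[OF _ assms])
  then show ?thesis
    unfolding hol_maps_def mem_Collect_eq * by blast
qed

abbreviation unit_ball :: "(complex ^ 'n) set"
  where "unit_ball \<equiv> ball 0 1"

abbreviation unit_disc :: "complex set"
  where "unit_disc \<equiv> ball 0 1"

definition is_domain :: "'a::topological_space set \<Rightarrow> bool"
  where "is_domain D \<longleftrightarrow> open D \<and> connected D \<and> D \<noteq> {}"

definition biholomorphic :: "(complex ^ 'n) set \<Rightarrow> (complex ^ 'n) set \<Rightarrow> bool"
  where "biholomorphic D E \<longleftrightarrow>
    (\<exists>f g. f \<in> hol_maps (*s) (*s) D E \<and> g \<in> hol_maps (*s) (*s) E D \<and>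
       (\<forall>x\<in>D. g (f x) = x) \<and> (\<forall>y\<in>E. f (g y) = y))"

definition squeezing :: "(complex ^ 'n) set \<Rightarrow> complex ^ 'n \<Rightarrow> real"
  where "squeezing (D :: (complex ^ 'n) set) z =
    (if \<exists>E. is_domain E \<and> bounded E \<and> biholomorphic D E
     then Sup {r. r > 0 \<and>
                (\<exists>f \<in> hol_maps (*s) (*s) D (unit_ball :: (complex ^ 'n) set).
                   f z = 0 \<and> inj_on f D \<and> ball 0 r \<subseteq> f ` D)}
     else 0)"

definition caratheodory :: "(complex ^ 'n) set \<Rightarrow> complex ^ 'n \<Rightarrow> complex ^ 'n \<Rightarrow> ereal"
  where "caratheodory D z w =
    Sup {ereal (artanh (norm \<zeta>)) | f \<zeta>. f \<in> hol_maps (*s) (*) D unit_disc \<and> f z = 0 \<and> f w = \<zeta>}"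

definition lempert :: "(complex ^ 'n) set \<Rightarrow> complex ^ 'n \<Rightarrow> complex ^ 'n \<Rightarrow> ereal"
  where "lempert D z w =
    Inf {ereal (artanh (norm \<zeta>)) | f \<zeta>. \<zeta> \<in> unit_disc \<and>
           f \<in> hol_maps (*) (*s) unit_disc D \<and> f 0 = z \<and> f \<zeta> = w}"

definition pseudodistance_on :: "'a set \<Rightarrow> ('a \<Rightarrow> 'a \<Rightarrow> real) \<Rightarrow> bool"
  where "pseudodistance_on D d \<longleftrightarrow>
    (\<forall>x\<in>D. \<forall>y\<in>D. d x y \<ge> 0 \<and> d x y = d y x) \<and> (\<forall>x\<in>D. d x x = 0) \<and>
    (\<forall>x\<in>D. \<forall>y\<in>D. \<forall>z\<in>D. d x z \<le> d x y + d y z)"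

text \<open>
  The largest pseudodistance below the Lempert function is the pointwise supremum of all
  of them; that this supremum is finite and is itself such a pseudodistance on a domain is
  lemma \<open>kobayashi_greatest\<close> below.
\<close>

definition kobayashi :: "(complex ^ 'n) set \<Rightarrow> complex ^ 'n \<Rightarrow> complex ^ 'n \<Rightarrow> ereal"
  where "kobayashi D z w =
    Sup {ereal (d z w) | d. pseudodistance_on D d \<and>
           (\<forall>x\<in>D. \<forall>y\<in>D. ereal (d x y) \<le> lempert D x y)}"

text \<open>
  The parameter \<open>d\<close> is the pseudodistance, to be instantiated with \<open>caratheodory D\<close> or
  \<open>kobayashi D\<close>. The empty case is separate because \<open>Sup {}\<close> is unspecified on \<open>real\<close>.
\<close>

definition fridman ::
  "(complex ^ 'n \<Rightarrow> complex ^ 'n \<Rightarrow> ereal) \<Rightarrow> (complex ^ 'n) set \<Rightarrow> complex ^ 'n \<Rightarrow> real"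
  where "fridman d (D :: (complex ^ 'n) set) z =
    (let R = {tanh r | r. r > 0 \<and>
                (\<exists>f \<in> hol_maps (*s) (*s) (unit_ball :: (complex ^ 'n) set) D.
                   inj_on f unit_ball \<and> {w \<in> D. d z w < ereal r} \<subseteq> f ` unit_ball)}
     in if R = {} then 0 else Sup R)"

lemma lempert_nonneg: "0 \<le> lempert D z w"
proof -
  have "0 \<le> artanh (norm l)" if "norm l < 1" for l :: complex
    using that by (auto simp: artanh_def)
  then show ?thesis
    unfolding lempert_def by (intro Inf_greatest) auto
qed

lemma lempert_ball_le:
  fixes a w :: "complex ^ 'n"
  assumes "0 < e" "ball a e \<subseteq> D" "w \<in> ball a e"
  shows "lempert D a w \<le> ereal (artanh (norm (w - a) / e))"
proof -
  define g :: "complex \<Rightarrow> complex ^ 'n" where "g t = (e / norm (w - a)) *\<^sub>R (t *s (w - a))" for t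
  define f where "f t = a + g t" for t
  have nv: "norm (t *s v) = norm t * norm v" for t :: complex and v :: "complex ^ 'n"
    by (simp add: norm_vec_def L2_set_right_distrib norm_mult)
  have vs: "vector_space ((*) :: complex \<Rightarrow> complex \<Rightarrow> complex)"
    by (rule vector_space_over_itself.vector_space_axioms)
  have "linear g"
    by (rule linearI) (auto simp: g_def vec_eq_iff algebra_simps)
  then have "bounded_linear g"
    by (rule linear_conv_bounded_linear[THEN iffD1])
  then have "(f has_derivative g) (at t)" for t
    unfolding f_def by (auto intro!: derivative_eq_intros bounded_linear_imp_has_derivative)
  moreover have "Vector_Spaces.linear (*) (*s) g"
    using vs vec.vector_space_axioms unfolding Vector_Spaces.linear_iff
    by (auto simp: g_def vec_eq_iff algebra_simps)
  moreover have "f ` unit_disc \<subseteq> D"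
  proof -
    have "norm (g t) < e" if "norm t < 1" for t
    proof (cases "w = a")
      case False
      then have "norm (g t) = e * norm t"
        using assms(1) unfolding g_def norm_scaleR nv by simp
      then show ?thesis
        using that assms(1) by simp
    qed (use assms(1) in \<open>simp add: g_def nv\<close>)
    then have "f t \<in> ball a e" if "norm t < 1" for t
      using that by (simp add: f_def dist_norm)
    with assms(2) show ?thesis by auto
  qed
  ultimately have f: "f \<in> hol_maps (*) (*s) unit_disc D"
    by (auto simp: hol_maps_def)
  have n: "norm (w - a) < e"
    using assms(3) by (simp add: dist_norm norm_minus_commute)
  define l where "l = complex_of_real (norm (w - a) / e)"
  have l: "norm l = norm (w - a) / e"
    using assms(1) by (simp add: l_def norm_divide)
  have "l \<in> unit_disc"
    using n assms(1) l by simp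
  moreover have "f 0 = a"
    by (simp add: f_def g_def vec_eq_iff)
  moreover have "f l = w"
  proof (cases "w = a")
    case False
    have "l *s (w - a) = (norm (w - a) / e) *\<^sub>R (w - a)"
      unfolding l_def by (simp only: vec_eq_iff vector_smult_component vector_scaleR_component
        scaleR_conv_of_real[where 'a = complex] simp_thms)
    with False have "g l = w - a"
      using assms(1) unfolding g_def by simp
    then show ?thesis
      by (simp add: f_def)
  qed (simp add: f_def g_def vec_eq_iff)
  ultimately show ?thesis
    unfolding lempert_def l[symmetric] using f by (intro Inf_lower) blast
qed

lemma kobayashi_greatest:
  fixes D :: "(complex ^ 'n) set"
  assumes "is_domain D"
  obtains k where "pseudodistance_on D k"
    and "\<And>x y. x \<in> D \<Longrightarrow> y \<in> D \<Longrightarrow> kobayashi D x y = ereal (k x y)"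
    and "\<And>x y. x \<in> D \<Longrightarrow> y \<in> D \<Longrightarrow> ereal (k x y) \<le> lempert D x y"
    and "\<And>d x y. pseudodistance_on D d \<Longrightarrow>
           (\<And>u v. u \<in> D \<Longrightarrow> v \<in> D \<Longrightarrow> ereal (d u v) \<le> lempert D u v) \<Longrightarrow>
           x \<in> D \<Longrightarrow> y \<in> D \<Longrightarrow> d x y \<le> k x y"
proof -
  define F where
    "F = {d. pseudodistance_on D d \<and> (\<forall>x\<in>D. \<forall>y\<in>D. ereal (d x y) \<le> lempert D x y)}"
  have Fp: "pseudodistance_on D d" if "d \<in> F" for d
    using that by (simp add: F_def)
  have Fl: "ereal (d x y) \<le> lempert D x y" if "d \<in> F" "x \<in> D" "y \<in> D" for d x y
    using that by (simp add: F_def)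
  have Fsym: "d x y = d y x" and Fzero: "d x x = 0" and Ftri: "d x z \<le> d x y + d y z"
    if "d \<in> F" "x \<in> D" "y \<in> D" "z \<in> D" for d x y z
    using Fp[OF that(1)] that(2-4) unfolding pseudodistance_on_def by blast+
  have F0: "(\<lambda>x y. 0) \<in> F"
    using lempert_nonneg by (auto simp: F_def pseudodistance_on_def zero_ereal_def[symmetric])
  have K: "kobayashi D x y = (SUP d\<in>F. ereal (d x y))" for x y
    unfolding kobayashi_def F_def by (rule arg_cong[where f = Sup]) auto
  have op: "open D" and co: "connected D"
    using assms by (auto simp: is_domain_def)
  have bd: "\<exists>M. \<forall>d\<in>F. d x y \<le> M" if "x \<in> D" "y \<in> D" for x y
  proof (rule connected_equivalence_relation[OF co that])
    fix x y assume "\<exists>M. \<forall>d\<in>F. d x y \<le> M" and xy: "x \<in> D" "y \<in> D"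
    then obtain M where M: "\<forall>d\<in>F. d x y \<le> M"
      by blast
    have "d y x \<le> M" if "d \<in> F" for d
      using Fsym[OF that xy xy(1)] bspec[OF M that] by linarith
    then show "\<exists>M. \<forall>d\<in>F. d y x \<le> M"
      by blast
  next
    fix x y z assume a: "\<exists>M. \<forall>d\<in>F. d x y \<le> M" "\<exists>M. \<forall>d\<in>F. d y z \<le> M" "x \<in> D" "y \<in> D" "z \<in> D"
    then obtain M N where MN: "\<forall>d\<in>F. d x y \<le> M" "\<forall>d\<in>F. d y z \<le> N"
      by blast
    have "d x z \<le> M + N" if "d \<in> F" for d
      using Ftri[OF that a(3-5)] bspec[OF MN(1) that] bspec[OF MN(2) that] by linarith
    then show "\<exists>M. \<forall>d\<in>F. d x z \<le> M" by blast
  next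
    fix a assume a: "a \<in> D"
    then obtain e where e: "0 < e" "ball a e \<subseteq> D"
      using op by (meson open_contains_ball)
    have "\<exists>M. \<forall>d\<in>F. d a x \<le> M" if "x \<in> ball a e" for x
    proof -
      have "d a x \<le> artanh (norm (x - a) / e)" if "d \<in> F" for d
      proof -
        have "ereal (d a x) \<le> ereal (artanh (norm (x - a) / e))"
          using Fl[OF that a subsetD[OF e(2) \<open>x \<in> ball a e\<close>]]
            lempert_ball_le[OF e \<open>x \<in> ball a e\<close>] by (rule order_trans)
        then show ?thesis by simp
      qed
      then show ?thesis by blast
    qed
    moreover have "openin (top_of_set D) (ball a e)"
      using e by (simp add: open_subset)
    ultimately show "\<exists>T. openin (top_of_set D) T \<and> a \<in> T \<and> (\<forall>x\<in>T. \<exists>M. \<forall>d\<in>F. d a x \<le> M)"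
      using e(1) by (intro exI[of _ "ball a e"]) simp
  qed
  define k where "k x y = (SUP d\<in>F. d x y)" for x y
  have bdd: "bdd_above ((\<lambda>d. d x y) ` F)" if "x \<in> D" "y \<in> D" for x y
    using bd[OF that] by (auto simp: bdd_above_def)
  have up: "d x y \<le> k x y" if "d \<in> F" "x \<in> D" "y \<in> D" for d x y
    unfolding k_def using that by (intro cSUP_upper bdd)
  have least: "k x y \<le> M" if "\<And>d. d \<in> F \<Longrightarrow> d x y \<le> M" for x y M
    unfolding k_def using F0 that by (intro cSUP_least) auto
  have kK: "kobayashi D x y = ereal (k x y)" if "x \<in> D" "y \<in> D" for x y
  proof (rule antisym)
    show "kobayashi D x y \<le> ereal (k x y)"
      unfolding K by (intro SUP_least) (simp only: ereal_less_eq up[OF _ that])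
    show "ereal (k x y) \<le> kobayashi D x y"
    proof (rule ereal_le_real)
      fix M assume "kobayashi D x y \<le> ereal M"
      then have "\<forall>d\<in>F. d x y \<le> M"
        unfolding K by (simp add: SUP_le_iff)
      then show "ereal (k x y) \<le> ereal M"
        unfolding ereal_less_eq by (intro least) (erule bspec)
    qed
  qed
  have "pseudodistance_on D k"
    unfolding pseudodistance_on_def
  proof (intro conjI ballI)
    fix x y assume xy: "x \<in> D" "y \<in> D"
    show "0 \<le> k x y"
      using up[OF F0 xy] .
    have "k u v \<le> k v u" if "u \<in> D" "v \<in> D" for u v
    proof (rule least)
      fix d assume "d \<in> F"
      then show "d u v \<le> k v u"
        using up[OF _ that(2,1)] Fsym[OF _ that that(1)] by metis
    qed
    then show "k x y = k y x"
      using xy by (intro antisym)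
  next
    fix x assume x: "x \<in> D"
    have "k x x \<le> 0"
      by (intro least eq_refl Fzero[OF _ x x x])
    then show "k x x = 0"
      using up[OF F0 x x] by (rule antisym)
  next
    fix x y z assume D: "x \<in> D" "y \<in> D" "z \<in> D"
    show "k x z \<le> k x y + k y z"
    proof (rule least)
      fix d assume d: "d \<in> F"
      have "d x z \<le> d x y + d y z"
        using Ftri[OF d D] .
      also have "\<dots> \<le> k x y + k y z"
        by (intro add_mono up d D)
      finally show "d x z \<le> k x y + k y z" .
    qed
  qed
  moreover have "ereal (k x y) \<le> lempert D x y" if "x \<in> D" "y \<in> D" for x y
    unfolding kK[OF that, symmetric] K by (intro SUP_least Fl that)
  moreover have "d x y \<le> k x y"
    if "pseudodistance_on D d" "\<And>u v. u \<in> D \<Longrightarrow> v \<in> D \<Longrightarrow> ereal (d u v) \<le> lempert D u v"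
      "x \<in> D" "y \<in> D" for d x y
    using that by (intro up) (auto simp: F_def)
  ultimately show thesis
    using that kK by blast
qed

end

theory Submission
  imports Defs "HOL-Complex_Analysis.Riemann_Mapping"
begin

unbundle no fps_syntax

text \<open>
  If \<open>f\<close> is a competitor for the squeezing function with \<open>r\<close> times the unit ball inside \<open>f ` D\<close>,
  then \<open>x \<mapsto> inv f (r x)\<close> is a competitor for the Fridman invariant: composing \<open>f\<close> with linear
  functionals shows that \<open>f\<close> maps the Caratheodory ball of radius \<open>artanh r\<close> into the ball of
  radius \<open>r\<close>. The second inequality is monotonicity of the Fridman invariant, because the Poincare
  distance pulled back along a map to the disc is, by Schwarz-Pick, a pseudodistance below the
  Lempert function.

  The substance is Osgood's theorem that \<open>inv f\<close> is holomorphic, i.e. that \<open>f'\<close> is nowhere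
  singular. With \<open>g = inv f\<close>, which is continuous by invariance of domain, and \<open>u = det f' \<circ> g\<close>,
  the difference quotients of \<open>g\<close> on a complex line are continuous, and holomorphic where \<open>u \<noteq> 0\<close>, so that the
  maximum principle bounds the derivatives of \<open>g\<close> locally uniformly off \<open>{u = 0}\<close>. By Sard's
  theorem this set has empty interior. At a point with \<open>u = 0\<close>, every \<open>v\<close> is then a limit of
  values \<open>f'(z\<^sub>k) y\<^sub>k\<close> with \<open>y\<^sub>k\<close> bounded, and compactness makes \<open>f'\<close> surjective there.
\<close>

section \<open>Holomorphic maps between complex vector spaces\<close>

lemma norm_vector_scalar_mult:
  fixes v :: "complex ^ 'n"
  shows "norm (c *s v) = norm c * norm v"
  by (simp add: norm_vec_def L2_set_right_distrib norm_mult)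

lemma hol_maps_compose:
  assumes "f \<in> hol_maps sa sb X Y" "g \<in> hol_maps sb sc Y Z"
  shows "g \<circ> f \<in> hol_maps sa sc X Z"
proof -
  have "\<exists>h'. (g \<circ> f has_derivative h') (at x) \<and> Vector_Spaces.linear sa sc h'" if "x \<in> X" for x
  proof -
    have "f x \<in> Y" using assms(1) that by (auto simp: hol_maps_def)
    obtain f' where f': "(f has_derivative f') (at x)" "Vector_Spaces.linear sa sb f'"
      using assms(1) \<open>x \<in> X\<close> by (auto simp: hol_maps_def)
    obtain g' where g': "(g has_derivative g') (at (f x))" "Vector_Spaces.linear sb sc g'"
      using assms(2) \<open>f x \<in> Y\<close> by (auto simp: hol_maps_def)
    show ?thesis
      using diff_chain_at[OF f'(1) g'(1)] Vector_Spaces.linear_compose[OF f'(2) g'(2)] by blast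
  qed
  moreover have "(g \<circ> f) ` X \<subseteq> Z"
    using assms by (force simp: hol_maps_def)
  ultimately show ?thesis by (simp add: hol_maps_def)
qed

text \<open>The target \<open>Y'\<close> is independent of \<open>Y\<close>: a map is first shown to
  be holomorphic into \<open>UNIV\<close> and receives its actual target here.\<close>

lemma hol_maps_mono:
  assumes "f \<in> hol_maps sa sb X Y" "X' \<subseteq> X" "f ` X' \<subseteq> Y'"
  shows "f \<in> hol_maps sa sb X' Y'"
  using assms unfolding hol_maps_def by blast

section \<open>Affine maps and linear functionals\<close>

lemma hol_maps_affine:
  assumes "linear L" "Vector_Spaces.linear sa sb L"
  shows "(\<lambda>z::'a::euclidean_space. c + L z :: 'b::real_normed_vector) \<in> hol_maps sa sb X UNIV"
proof -
  have "((\<lambda>z. c + L z) has_derivative L) (at z)" for z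
    using assms(1) by (auto intro!: derivative_eq_intros bounded_linear_imp_has_derivative
      simp: linear_conv_bounded_linear)
  then show ?thesis using assms(2) by (auto simp: hol_maps_def)
qed

lemma hol_maps_continuous_on:
  assumes "f \<in> hol_maps sa sb X Y"
  shows "continuous_on X f"
  using assms unfolding hol_maps_def
  by (blast intro: has_derivative_continuous continuous_at_imp_continuous_on)

lemma vector_space_complex: "vector_space ((*) :: complex \<Rightarrow> complex \<Rightarrow> complex)"
  by (rule vector_space_over_itself.vector_space_axioms)

lemma hol_maps_line:
  fixes w v :: "complex ^ 'n"
  shows "(\<lambda>t. w + t *s v) \<in> hol_maps (*) (*s) X UNIV"
proof (rule hol_maps_affine)
  show "linear (\<lambda>t. t *s v)"
    by (rule linearI) (auto simp: vec_eq_iff algebra_simps)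
  show "Vector_Spaces.linear (*) (*s) (\<lambda>t. t *s v)"
    using vector_space_complex vec.vector_space_axioms unfolding Vector_Spaces.linear_iff
    by (auto simp: vec_eq_iff algebra_simps)
qed

lemma hol_maps_functional:
  fixes a :: "complex ^ 'n"
  shows "(\<lambda>z. \<Sum>i\<in>UNIV. a $ i * z $ i) \<in> hol_maps (*s) (*) X UNIV"
proof -
  let ?L = "\<lambda>z::complex ^ 'n. \<Sum>i\<in>UNIV. a $ i * z $ i"
  have "linear ?L"
    by (rule linearI) (auto simp: algebra_simps sum.distrib scaleR_sum_right)
  moreover have "Vector_Spaces.linear (*s) (*) ?L"
    using vector_space_complex vec.vector_space_axioms unfolding Vector_Spaces.linear_iff
    by (auto simp: algebra_simps sum.distrib sum_distrib_left)
  ultimately show ?thesis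
    using hol_maps_affine[of ?L "(*s)" "(*)" 0 X] by simp
qed

lemma hol_maps_component:
  "(\<lambda>z :: complex ^ 'n. z $ i) \<in> hol_maps (*s) (*) X UNIV"
proof -
  have "(\<Sum>j\<in>UNIV. axis i 1 $ j * z $ j) = z $ i" for z :: "complex ^ 'n"
    by (simp add: axis_def if_distrib[where f = "\<lambda>x. x * _"] cong: if_cong)
  then show ?thesis
    using hol_maps_functional[of "axis i 1" X] by simp
qed

lemma hol_maps_scale_translate:
  fixes a :: "complex ^ 'n"
  shows "(\<lambda>z. a + c *s z) \<in> hol_maps (*s) (*s) X UNIV"
proof (rule hol_maps_affine)
  show "linear (\<lambda>z::complex ^ 'n. c *s z)"
    by (rule linearI) (auto simp: vec_eq_iff algebra_simps)
  show "Vector_Spaces.linear (*s) (*s) (\<lambda>z::complex ^ 'n. c *s z)"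
    using vec.vector_space_axioms unfolding Vector_Spaces.linear_iff
    by (auto simp: vec_eq_iff algebra_simps)
qed

section \<open>Estimates in one variable and Sard's theorem\<close>

text \<open>The left side is a first-order Taylor remainder divided by \<open>\<zeta>\<close>.
  Cauchy's estimate on discs of radius \<open>e / 4\<close> about points of
  \<open>cball 0 (e / 4)\<close>, which stay inside \<open>ball 0 e\<close>, bounds the second
  derivative. The bound sees \<open>\<phi>\<close> only through \<open>M\<close> and
  \<open>e\<close>, hence is uniform in families of such functions.\<close>

lemma difference_quotient_bound:
  assumes hol: "\<phi> holomorphic_on ball 0 e" and M: "\<And>x. x \<in> ball 0 e \<Longrightarrow> norm (\<phi> x) < M"
    and e: "0 < e" and \<zeta>: "\<zeta> \<noteq> 0" "norm \<zeta> \<le> e / 4"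
  shows "norm ((\<phi> \<zeta> - \<phi> 0) / \<zeta> - deriv \<phi> 0) \<le> 2 * M / (e / 4)\<^sup>2 * norm \<zeta>"
proof -
  let ?C = "2 * M / (e / 4)\<^sup>2"
  have "norm ((deriv ^^ 0) \<phi> \<zeta> - (\<Sum>i\<le>1. (deriv ^^ i) \<phi> 0 * (\<zeta> - 0) ^ i / fact i))
      \<le> ?C * norm (\<zeta> - 0) ^ Suc 1 / fact 1"
  proof (rule complex_Taylor[where S = "cball 0 (e / 4)"])
    fix i x assume "x \<in> cball (0::complex) (e / 4)"
    then have "x \<in> ball 0 e" using e by auto
    then have "((deriv ^^ i) \<phi> has_field_derivative (deriv ^^ Suc i) \<phi> x) (at x)"
      using hol by (intro has_field_derivative_higher_deriv) auto
    then show "((deriv ^^ i) \<phi> has_field_derivative (deriv ^^ Suc i) \<phi> x) (at x within cball 0 (e / 4))"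
      by (rule has_field_derivative_at_within)
  next
    fix x assume x: "x \<in> cball (0::complex) (e / 4)"
    have sub: "cball x (e / 4) \<subseteq> ball 0 e"
    proof
      fix y assume "y \<in> cball x (e / 4)"
      then have "norm (y - x) \<le> e / 4" by (simp add: dist_norm norm_minus_commute)
      then show "y \<in> ball 0 e"
        using x e norm_triangle_ineq[of x "y - x"] by simp
    qed
    have "norm ((deriv ^^ 2) \<phi> x) \<le> fact 2 * M / (e / 4) ^ 2"
    proof (rule Cauchy_higher_deriv_bound)
      show "\<phi> holomorphic_on ball x (e / 4)"
        using hol sub by (meson holomorphic_on_subset ball_subset_cball order_trans)
      show "continuous_on (cball x (e / 4)) \<phi>"
        using hol sub by (meson holomorphic_on_subset holomorphic_on_imp_continuous_on)
      show "\<phi> w \<in> ball 0 M" if "w \<in> ball x (e / 4)" for w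
        using M[OF subsetD[OF sub]] that by auto
    qed (use e in auto)
    then show "norm ((deriv ^^ Suc 1) \<phi> x) \<le> ?C"
      by (simp add: numeral_2_eq_2)
  qed (use e \<zeta> in auto)
  then have *: "norm (\<phi> \<zeta> - \<phi> 0 - deriv \<phi> 0 * \<zeta>) \<le> ?C * norm \<zeta> * norm \<zeta>"
    by (simp add: power2_eq_square algebra_simps)
  have "(\<phi> \<zeta> - \<phi> 0) / \<zeta> - deriv \<phi> 0 = (\<phi> \<zeta> - \<phi> 0 - deriv \<phi> 0 * \<zeta>) / \<zeta>"
    using \<zeta> by (simp add: diff_divide_distrib)
  moreover have "norm ((\<phi> \<zeta> - \<phi> 0 - deriv \<phi> 0 * \<zeta>) / \<zeta>) \<le> ?C * norm \<zeta>"
    unfolding norm_divide by (rule mult_imp_div_pos_le) (use \<zeta> in simp, fact *)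
  ultimately show ?thesis
    by (rule ssubst)
qed

text \<open>
  Applying the maximum principle to \<open>h ^ m * u\<close> on the open set where \<open>u\<close> does not vanish and
  letting \<open>m\<close> grow makes the factor \<open>u\<close> disappear from the bound.
\<close>

lemma maximum_modulus_off_zeros:
  fixes h u :: "complex \<Rightarrow> complex"
  assumes cont: "continuous_on (cball 0 \<rho>) h" "continuous_on (cball 0 \<rho>) u"
    and hol: "h holomorphic_on {t \<in> ball 0 \<rho>. u t \<noteq> 0}" "u holomorphic_on {t \<in> ball 0 \<rho>. u t \<noteq> 0}"
    and B: "\<And>t. norm t = \<rho> \<Longrightarrow> norm (h t) \<le> B"
    and u0: "u 0 \<noteq> 0" and \<rho>: "0 < \<rho>"
  shows "norm (h 0) \<le> B"
proof (rule ccontr)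
  assume neg: "\<not> norm (h 0) \<le> B"
  have B0: "0 \<le> B"
    by (rule order_trans[OF norm_ge_zero B[of "of_real \<rho>"]]) (use \<rho> in simp)
  define S where "S = {t \<in> ball 0 \<rho>. u t \<noteq> 0}"
  have S_eq: "S = ball 0 \<rho> \<inter> u -` (- {0})" by (auto simp: S_def)
  have "open S"
    unfolding S_eq using cont(2)
    by (intro continuous_open_preimage) (auto intro: continuous_on_subset)
  have Sc: "closure S \<subseteq> cball 0 \<rho>"
    by (rule closure_minimal) (auto simp: S_def)
  obtain U where U: "\<And>t. t \<in> cball 0 \<rho> \<Longrightarrow> norm (u t) \<le> U"
    using compact_continuous_image[OF cont(2) compact_cball]
    by (meson bounded_iff compact_imp_bounded imageI)
  have bound: "norm (h 0) ^ m * norm (u 0) \<le> B ^ m * U" if "0 < m" for m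
  proof -
    have "norm (h 0 ^ m * u 0) \<le> B ^ m * U"
    proof (rule maximum_modulus_frontier[where f = "\<lambda>t. h t ^ m * u t" and S = S])
      show "(\<lambda>t. h t ^ m * u t) holomorphic_on interior S"
        using hol \<open>open S\<close> by (auto simp: interior_open S_def intro!: holomorphic_intros)
      show "continuous_on (closure S) (\<lambda>t. h t ^ m * u t)"
        using cont Sc by (auto intro!: continuous_intros elim: continuous_on_subset)
      show "bounded S"
        by (rule bounded_subset[OF bounded_ball[of 0 \<rho>]]) (auto simp: S_def)
      show "0 \<in> S" using u0 \<rho> by (simp add: S_def)
      fix t assume t: "t \<in> frontier S"
      then have tc: "t \<in> cball 0 \<rho>" and tS: "t \<notin> S"
        using Sc \<open>open S\<close> by (auto simp: frontier_def interior_open)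
      \<comment> \<open>A frontier point of \<open>S\<close> is either a zero of \<open>u\<close>,
        where the product vanishes, or lies on the circle of radius \<open>\<rho>\<close>, where
        \<open>B\<close> applies.\<close>
      show "norm (h t ^ m * u t) \<le> B ^ m * U"
      proof (cases "u t = 0")
        case True
        then show ?thesis
          using B0 order_trans[OF norm_ge_zero U[of 0]] \<rho> by simp
      next
        case False
        then have "norm t = \<rho>" using tc tS by (auto simp: S_def)
        then show ?thesis
          unfolding norm_mult norm_power using B B0 U[OF tc]
          by (intro mult_mono power_mono) auto
      qed
    qed
    then show ?thesis by (simp add: norm_mult norm_power)
  qed
  have pos: "0 < norm (h 0)" using neg B0 by linarith
  have "(\<lambda>m. (B / norm (h 0)) ^ m * U) \<longlonglongrightarrow> 0 * U"
    using neg B0 pos by (intro tendsto_intros LIMSEQ_power_zero) auto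
  moreover have "norm (u 0) \<le> (B / norm (h 0)) ^ m * U" if "m \<ge> 1" for m
    using bound[of m] that pos by (simp add: power_divide field_simps)
  ultimately have "norm (u 0) \<le> 0 * U"
    by (intro LIMSEQ_le_const) auto
  then show False using u0 by simp
qed

text \<open>A real linear isomorphism moves \<open>f\<close> to real coordinates. There the image
  would be open by invariance of domain and negligible by Sard's theorem, which is impossible for a
  nonempty set.\<close>

lemma singular_derivative_not_injective:
  fixes f :: "complex ^ 'n \<Rightarrow> complex ^ 'n"
  assumes "open U" "U \<noteq> {}"
    and der: "\<And>x. x \<in> U \<Longrightarrow> (f has_derivative f' x) (at x)"
    and sing: "\<And>x. x \<in> U \<Longrightarrow> \<not> inj (f' x)"
  shows "\<not> inj_on f U"
proof
  assume inj: "inj_on f U"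
  \<comment> \<open>The index type \<open>'n bit0\<close> has twice as many elements as
    \<open>'n\<close>, which matches the real dimension of \<open>complex ^ 'n\<close>.\<close>
  have "DIM(real ^ 'n bit0) = DIM(complex ^ 'n)"
    by simp
  then obtain \<phi> :: "real ^ 'n bit0 \<Rightarrow> complex ^ 'n" and \<psi>
    where lin: "linear \<phi>" "linear \<psi>" and inv: "\<And>x. \<psi> (\<phi> x) = x" "\<And>y. \<phi> (\<psi> y) = y"
    using isomorphisms_UNIV_UNIV by metis
  have bl: "bounded_linear \<phi>" "bounded_linear \<psi>"
    using lin by (auto simp: linear_conv_bounded_linear)
  define V where "V = \<phi> -` U"
  define F where "F = \<psi> \<circ> f \<circ> \<phi>"
  define F' where "F' x = \<psi> \<circ> f' (\<phi> x) \<circ> \<phi>" for x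
  have dF: "(F has_derivative F' x) (at x)" if "x \<in> V" for x
    unfolding F_def F'_def using that der[of "\<phi> x"] bl
    by (intro diff_chain_at) (auto simp: V_def intro: bounded_linear_imp_has_derivative)
  have "open V"
    unfolding V_def using assms(1) linear_continuous_on[OF bl(1), of UNIV]
    by (metis continuous_on_open_vimage open_UNIV Int_UNIV_right)
  have "inj_on F V"
  proof (rule inj_onI)
    fix x y assume xy: "x \<in> V" "y \<in> V" "F x = F y"
    then have "\<phi> (\<psi> (f (\<phi> x))) = \<phi> (\<psi> (f (\<phi> y)))"
      by (simp add: F_def)
    then have "\<phi> x = \<phi> y"
      unfolding inv using inj_onD[OF inj] xy by (simp add: V_def)
    then show "x = y"
      by (metis inv(1))
  qed
  then have "open (F ` V)"
    using dF \<open>open V\<close>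
    by (intro invariance_of_domain continuous_at_imp_continuous_on)
       (auto intro: has_derivative_continuous)
  moreover have "negligible (F ` V)"
  proof (rule baby_Sard)
    fix x assume x: "x \<in> V"
    show "(F has_derivative F' x) (at x within V)"
      using dF[OF x] by (rule has_derivative_at_withinI)
    have "linear (F' x)"
      using dF[OF x] by (rule has_derivative_linear)
    moreover have "\<not> inj (F' x)"
    proof -
      obtain a b where "a \<noteq> b" "f' (\<phi> x) a = f' (\<phi> x) b"
        using sing[of "\<phi> x"] x by (auto simp: V_def inj_def)
      then have "F' x (\<psi> a) = F' x (\<psi> b)"
        by (simp add: F'_def inv)
      moreover have "\<psi> a \<noteq> \<psi> b"
        using \<open>a \<noteq> b\<close> by (metis inv(2))
      ultimately show ?thesis by (auto simp: inj_def)
    qed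
    ultimately show "rank (matrix (F' x)) < CARD('n bit0)"
      unfolding less_rank_noninjective by (simp add: matrix_works)
  qed simp
  moreover have "F ` V \<noteq> {}"
  proof -
    obtain y where "y \<in> U" using assms(2) by blast
    then have "\<psi> y \<in> V" by (simp add: V_def inv)
    then show ?thesis by blast
  qed
  ultimately show False
    using open_not_negligible by blast
qed

section \<open>Directional derivatives and the Jacobian determinant\<close>

lemma line_has_derivative:
  fixes v :: "complex ^ 'n"
  shows "((\<lambda>t. w + t *s v) has_derivative (\<lambda>t. t *s v)) (at t)"
proof -
  have "linear (\<lambda>t. t *s v)"
    by (rule linearI) (auto simp: vec_eq_iff algebra_simps)
  then show ?thesis
    by (auto intro!: derivative_eq_intros bounded_linear_imp_has_derivative
      simp: linear_conv_bounded_linear)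
qed

lemma has_field_derivative_along_line:
  fixes v :: "complex ^ 'n"
  assumes "(f has_derivative f') (at (w + t *s v))" "Vector_Spaces.linear (*s) (*) f'"
  shows "((\<lambda>t. f (w + t *s v)) has_field_derivative f' v) (at t)"
proof -
  have "(f \<circ> (\<lambda>t. w + t *s v) has_derivative f' \<circ> (\<lambda>t. t *s v)) (at t)"
    by (rule diff_chain_at[OF line_has_derivative assms(1)])
  moreover have "f' (s *s v) = f' v * s" for s
    using assms(2) unfolding Vector_Spaces.linear_iff by (simp add: mult.commute)
  ultimately show ?thesis
    by (simp add: has_field_derivative_def o_def)
qed

lemma linear_component:
  fixes L :: "_ \<Rightarrow> complex ^ 'n"
  assumes "Vector_Spaces.linear sa (*s) L"
  shows "Vector_Spaces.linear sa (*) (\<lambda>x. L x $ i)"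
  using assms vector_space_complex unfolding Vector_Spaces.linear_iff by auto

lemma hol_maps_diff_quotient:
  assumes "f \<in> hol_maps sa (*) X UNIV" "g \<in> hol_maps sa (*) X UNIV"
  shows "(\<lambda>z. (f z - g z) / c) \<in> hol_maps sa (*) X UNIV"
proof -
  have "\<exists>h'. ((\<lambda>z. (f z - g z) / c) has_derivative h') (at z) \<and> Vector_Spaces.linear sa (*) h'"
    if z: "z \<in> X" for z
  proof -
    obtain f' where f': "(f has_derivative f') (at z)" "Vector_Spaces.linear sa (*) f'"
      using assms(1) z by (auto simp: hol_maps_def)
    obtain g' where g': "(g has_derivative g') (at z)" "Vector_Spaces.linear sa (*) g'"
      using assms(2) z by (auto simp: hol_maps_def)
    have "((\<lambda>z. (f z - g z) * inverse c) has_derivative (\<lambda>h. (f' h - g' h) * inverse c)) (at z)"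
      using f'(1) g'(1) by (auto intro!: derivative_eq_intros)
    moreover have "Vector_Spaces.linear sa (*) (\<lambda>h. (f' h - g' h) * inverse c)"
      using f'(2) g'(2) unfolding Vector_Spaces.linear_iff by (simp add: algebra_simps)
    ultimately show ?thesis
      unfolding divide_inverse by blast
  qed
  then show ?thesis by (simp add: hol_maps_def)
qed

text \<open>
  Working with this notion avoids having to show that the partial derivatives of a holomorphic
  function of several variables are totally differentiable.
\<close>

definition curve_holomorphic :: "(complex ^ 'n) set \<Rightarrow> (complex ^ 'n \<Rightarrow> complex) \<Rightarrow> bool"
  where "curve_holomorphic D h \<longleftrightarrow> continuous_on D h \<and>
    (\<forall>T \<gamma>. open T \<longrightarrow> \<gamma> \<in> hol_maps (*) (*s) T D \<longrightarrow> (\<lambda>t. h (\<gamma> t)) holomorphic_on T)"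

lemma hol_maps_curve_holomorphic:
  assumes "f \<in> hol_maps (*s) (*) D UNIV"
  shows "curve_holomorphic D f"
  unfolding curve_holomorphic_def
proof (intro conjI allI impI)
  show "continuous_on D f" using assms by (rule hol_maps_continuous_on)
  fix T \<gamma> assume "open T" "\<gamma> \<in> hol_maps (*) (*s) T D"
  then have "f \<circ> \<gamma> \<in> hol_maps (*) (*) T UNIV"
    using assms by (intro hol_maps_compose)
  then show "(\<lambda>t. f (\<gamma> t)) holomorphic_on T"
    using \<open>open T\<close> by (simp add: hol_maps_complex_iff o_def)
qed

text \<open>Along a curve this is Weierstrass's theorem on uniform limits of holomorphic functions:
  near \<open>t\<close> the curve stays in a ball on which \<open>q\<close> converges uniformly, and
  composing with the curve keeps the convergence uniform.\<close>

lemma curve_holomorphic_local_uniform_limit: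
  assumes "open D"
    and lim: "\<And>p. p \<in> D \<Longrightarrow> \<exists>r>0. \<exists>q. ball p r \<subseteq> D \<and> (\<forall>m. curve_holomorphic (ball p r) (q m)) \<and>
      uniform_limit (ball p r) q h sequentially"
  shows "curve_holomorphic D h"
  unfolding curve_holomorphic_def
proof (intro conjI allI impI)
  have "isCont h p" if "p \<in> D" for p
  proof -
    obtain r q where r: "0 < r" "\<forall>m. curve_holomorphic (ball p r) (q m)"
        "uniform_limit (ball p r) q h sequentially"
      using lim[OF \<open>p \<in> D\<close>] by blast
    have "continuous_on (ball p r) h"
      by (rule uniform_limit_theorem[OF _ r(3)])
         (use r(2) in \<open>auto simp: curve_holomorphic_def\<close>)
    then show ?thesis
      using r(1) by (simp add: continuous_on_eq_continuous_at)
  qed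
  then show "continuous_on D h" by (simp add: continuous_at_imp_continuous_on)
next
  fix T \<gamma> assume T: "open T" and \<gamma>: "\<gamma> \<in> hol_maps (*) (*s) T D"
  have "(\<lambda>t. h (\<gamma> t)) field_differentiable (at t)" if "t \<in> T" for t
  proof -
    have "\<gamma> t \<in> D" using \<gamma> that by (auto simp: hol_maps_def)
    then obtain r q where r: "0 < r" "\<forall>m. curve_holomorphic (ball (\<gamma> t) r) (q m)"
        "uniform_limit (ball (\<gamma> t) r) q h sequentially"
      using lim[OF \<open>\<gamma> t \<in> D\<close>] by blast
    define T' where "T' = T \<inter> \<gamma> -` ball (\<gamma> t) r"
    have "open T'"
      unfolding T'_def using hol_maps_continuous_on[OF \<gamma>] T
      by (intro continuous_open_preimage) auto
    moreover have "t \<in> T'" using that r(1) by (simp add: T'_def)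
    ultimately obtain \<delta> where \<delta>: "0 < \<delta>" "cball t \<delta> \<subseteq> T'"
      by (meson open_contains_cball)
    have "\<gamma> \<in> hol_maps (*) (*s) T' (ball (\<gamma> t) r)"
      using \<gamma> by (rule hol_maps_mono) (auto simp: T'_def)
    then have hol: "(\<lambda>s. q m (\<gamma> s)) holomorphic_on T'" for m
      using r(2) \<open>open T'\<close> by (auto simp: curve_holomorphic_def)
    have "uniform_limit (cball t \<delta>) (\<lambda>m s. q m (\<gamma> s)) (\<lambda>s. h (\<gamma> s)) sequentially"
      using r(3) by (rule uniform_limit_compose') (use \<delta>(2) in \<open>auto simp: T'_def\<close>)
    then have "(\<lambda>s. h (\<gamma> s)) holomorphic_on ball t \<delta>"
    proof (rule holomorphic_uniform_limit[rotated])
      show "\<forall>\<^sub>F m in sequentially. continuous_on (cball t \<delta>) (\<lambda>s. q m (\<gamma> s)) \<and>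
          (\<lambda>s. q m (\<gamma> s)) holomorphic_on ball t \<delta>"
      proof (intro always_eventually allI conjI)
        fix m
        have "(\<lambda>s. q m (\<gamma> s)) holomorphic_on cball t \<delta>"
          using hol \<delta>(2) by (rule holomorphic_on_subset)
        then show "continuous_on (cball t \<delta>) (\<lambda>s. q m (\<gamma> s))"
            "(\<lambda>s. q m (\<gamma> s)) holomorphic_on ball t \<delta>"
          by (auto intro: holomorphic_on_imp_continuous_on elim: holomorphic_on_subset)
      qed
    qed auto
    then show ?thesis
      using \<delta>(1) by (meson centre_in_ball holomorphic_on_imp_differentiable_at open_ball)
  qed
  then show "(\<lambda>t. h (\<gamma> t)) holomorphic_on T"
    unfolding holomorphic_on_def by (blast intro: field_differentiable_at_within)
qed

text \<open>Near each point the derivative along \<open>v\<close> is the uniform limit of the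
  difference quotients \<open>q m\<close>, which are holomorphic because \<open>f\<close> and its
  translates are. \<open>difference_quotient_bound\<close>, applied on complex lines with a common
  bound \<open>M\<close> for \<open>f\<close>, gives the uniformity; continuity of
  \<open>Df z v\<close> in \<open>z\<close> is a result and not an assumption.\<close>

lemma directional_derivative_curve_holomorphic:
  fixes f :: "complex ^ 'n \<Rightarrow> complex"
  assumes "open D" and der: "\<And>z. z \<in> D \<Longrightarrow> (f has_derivative Df z) (at z)"
    and lin: "\<And>z. z \<in> D \<Longrightarrow> Vector_Spaces.linear (*s) (*) (Df z)"
  shows "curve_holomorphic D (\<lambda>z. Df z v)"
proof (rule curve_holomorphic_local_uniform_limit[OF \<open>open D\<close>])
  fix p assume "p \<in> D"
  then obtain e0 where e0: "0 < e0" "cball p e0 \<subseteq> D"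
    using \<open>open D\<close> open_contains_cball by blast
  have f: "f \<in> hol_maps (*s) (*) D UNIV"
    using der lin by (auto simp: hol_maps_def)
  obtain M where M: "\<And>z. z \<in> cball p e0 \<Longrightarrow> norm (f z) < M"
  proof -
    have "bounded (f ` cball p e0)"
      using hol_maps_continuous_on[OF f] e0(2)
      by (meson compact_cball compact_continuous_image compact_imp_bounded continuous_on_subset)
    then obtain N where "\<forall>z\<in>cball p e0. norm (f z) \<le> N" by (auto simp: bounded_iff)
    \<comment> \<open>Adding 1 makes the bound strict, as \<open>difference_quotient_bound\<close>
      requires.\<close>
    then show thesis by (intro that[of "N + 1"]) force
  qed
  \<comment> \<open>Half of the radius is left for \<open>z\<close> and half for
    \<open>\<zeta> *s v\<close>; the summand 1 keeps the denominator positive when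
    \<open>v = 0\<close>.\<close>
  define e where "e = e0 / (2 * (norm v + 1))"
  have nv: "0 < norm v + 1" by (simp add: add_nonneg_pos)
  then have e: "0 < e" using e0(1) by (simp add: e_def)
  have sub: "z + \<zeta> *s v \<in> cball p e0" if "z \<in> ball p (e0 / 2)" "\<zeta> \<in> ball 0 e" for z \<zeta>
  proof -
    have "norm \<zeta> * norm v \<le> e * (norm v + 1)"
      using that(2) e by (intro mult_mono) auto
    also have "\<dots> = e0 / 2" using nv unfolding e_def by (simp add: divide_simps)
    finally have "norm (\<zeta> *s v) \<le> e0 / 2" by (simp add: norm_vector_scalar_mult)
    moreover have "norm (z - p) < e0 / 2"
      using that(1) by (simp add: dist_norm norm_minus_commute)
    ultimately have "norm (z - p + \<zeta> *s v) \<le> e0"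
      by (smt (verit) norm_triangle_ineq field_sum_of_halves)
    then show ?thesis
      by (simp add: dist_norm norm_minus_commute[of p] algebra_simps)
  qed
  \<comment> \<open>\<open>Suc m\<close> keeps the increments nonzero already at
    \<open>m = 0\<close>, and the factor 1/4 is the range of
    \<open>difference_quotient_bound\<close>.\<close>
  define \<zeta> where "\<zeta> m = complex_of_real (e / 4 / real (Suc m))" for m
  define q where "q m z = (f (z + \<zeta> m *s v) - f z) / \<zeta> m" for m z
  have \<zeta>: "\<zeta> m \<noteq> 0" "norm (\<zeta> m) \<le> e / 4" "norm (\<zeta> m) < e" for m
  proof -
    have *: "norm (\<zeta> m) = e / 4 / real (Suc m)"
      unfolding \<zeta>_def norm_of_real using e by simp
    show "norm (\<zeta> m) \<le> e / 4"
      unfolding * using e by (simp add: divide_le_eq)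
    then show "norm (\<zeta> m) < e" using e by linarith
    have "0 < norm (\<zeta> m)" unfolding * using e by simp
    then show "\<zeta> m \<noteq> 0" by auto
  qed
  have est: "norm (q m z - Df z v) \<le> 2 * M / (e / 4)\<^sup>2 * norm (\<zeta> m)" if z: "z \<in> ball p (e0 / 2)" for m z
  proof -
    let ?\<phi> = "\<lambda>t. f (z + t *s v)"
    have d: "(?\<phi> has_field_derivative Df (z + t *s v) v) (at t)" if "t \<in> ball 0 e" for t
      using sub[OF z that] e0(2) by (intro has_field_derivative_along_line der lin) auto
    have "norm ((?\<phi> (\<zeta> m) - ?\<phi> 0) / \<zeta> m - deriv ?\<phi> 0) \<le> 2 * M / (e / 4)\<^sup>2 * norm (\<zeta> m)"
    proof (rule difference_quotient_bound)
      show "?\<phi> holomorphic_on ball 0 e"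
        unfolding holomorphic_on_open[OF open_ball] using d by blast
      show "norm (?\<phi> t) < M" if "t \<in> ball 0 e" for t
        using M[OF sub[OF z that]] .
    qed (use e \<zeta> in auto)
    moreover have "deriv ?\<phi> 0 = Df (z + 0 *s v) v"
      using d[of 0] e by (intro DERIV_imp_deriv) auto
    moreover have "z + 0 *s v = z" by (simp add: vec_eq_iff)
    ultimately show ?thesis by (simp add: q_def)
  qed
  have "uniform_limit (ball p (e0 / 2)) q (\<lambda>z. Df z v) sequentially"
  proof (rule uniform_limitI)
    fix \<epsilon> :: real assume "0 < \<epsilon>"
    have "(\<lambda>m. 2 * M / (e / 4)\<^sup>2 * norm (\<zeta> m)) \<longlonglongrightarrow> 2 * M / (e / 4)\<^sup>2 * norm (complex_of_real 0)"
      unfolding \<zeta>_def by (intro tendsto_intros LIMSEQ_Suc[OF lim_const_over_n])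
    then have "\<forall>\<^sub>F m in sequentially. 2 * M / (e / 4)\<^sup>2 * norm (\<zeta> m) < \<epsilon>"
      using \<open>0 < \<epsilon>\<close> by (auto dest: order_tendstoD)
    then show "\<forall>\<^sub>F m in sequentially. \<forall>z\<in>ball p (e0 / 2). dist (q m z) (Df z v) < \<epsilon>"
    proof (rule eventually_mono)
      fix m assume small: "2 * M / (e / 4)\<^sup>2 * norm (\<zeta> m) < \<epsilon>"
      show "\<forall>z\<in>ball p (e0 / 2). dist (q m z) (Df z v) < \<epsilon>"
        unfolding dist_norm using le_less_trans[OF est small] by blast
    qed
  qed
  moreover have "curve_holomorphic (ball p (e0 / 2)) (q m)" for m
    unfolding q_def
  proof (intro hol_maps_curve_holomorphic hol_maps_diff_quotient)
    show "f \<in> hol_maps (*s) (*) (ball p (e0 / 2)) UNIV"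
      using f e0 by (rule_tac hol_maps_mono) auto
    \<comment> \<open>A translation, written with the trivial factor 1 to be an instance of
      \<open>hol_maps_scale_translate\<close>.\<close>
    have "(\<lambda>z. \<zeta> m *s v + 1 *s z) \<in> hol_maps (*s) (*s) (ball p (e0 / 2)) D"
    proof (rule hol_maps_mono[OF hol_maps_scale_translate order_refl])
      show "(\<lambda>z. \<zeta> m *s v + 1 *s z) ` ball p (e0 / 2) \<subseteq> D"
        using sub[of _ "\<zeta> m"] \<zeta>(3) e0(2) by (auto simp: add.commute)
    qed
    from hol_maps_compose[OF this f]
    show "(\<lambda>z. f (z + \<zeta> m *s v)) \<in> hol_maps (*s) (*) (ball p (e0 / 2)) UNIV"
      by (simp add: o_def add.commute)
  qed
  moreover have "ball p (e0 / 2) \<subseteq> D" using e0 by auto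
  ultimately show "\<exists>r>0. \<exists>q. ball p r \<subseteq> D \<and> (\<forall>m. curve_holomorphic (ball p r) (q m)) \<and>
      uniform_limit (ball p r) q (\<lambda>z. Df z v) sequentially"
    using e0(1) by (intro exI[of _ "e0 / 2"] conjI exI[of _ q]) auto
qed

lemma curve_holomorphic_det:
  fixes A :: "complex ^ 'n \<Rightarrow> complex ^ 'm ^ 'm"
  assumes "\<And>i j. curve_holomorphic D (\<lambda>z. A z $ i $ j)"
  shows "curve_holomorphic D (\<lambda>z. det (A z))"
  unfolding curve_holomorphic_def det_def
proof (intro conjI allI impI)
  show "continuous_on D (\<lambda>z. \<Sum>p\<in>{p. p permutes UNIV}. of_int (sign p) * (\<Prod>i\<in>UNIV. A z $ i $ p i))"
    using assms unfolding curve_holomorphic_def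
    by (intro continuous_on_sum continuous_on_mult continuous_on_const continuous_on_prod) blast
  fix T \<gamma> assume T: "open T" "\<gamma> \<in> hol_maps (*) (*s) T D"
  then have "(\<lambda>t. A (\<gamma> t) $ i $ j) holomorphic_on T" for i j
    using assms by (simp add: curve_holomorphic_def)
  then show "(\<lambda>t. \<Sum>p\<in>{p. p permutes UNIV}. of_int (sign p) * (\<Prod>i\<in>UNIV. A (\<gamma> t) $ i $ p i)) holomorphic_on T"
    by (auto intro!: holomorphic_intros)
qed

text \<open>The derivative of \<open>g\<close> is multiplication by the inverse of the matrix of
  \<open>f'\<close>, hence complex linear. The last conclusion makes \<open>g' v\<close> a solution
  of \<open>f' y = v\<close>, the form in which Osgood's theorem uses it.\<close>

lemma has_derivative_inverse_holomorphic:
  fixes f :: "complex ^ 'n \<Rightarrow> complex ^ 'n"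
  assumes "open D" "continuous_on D f" and gf: "\<And>x. x \<in> D \<Longrightarrow> g (f x) = x" and "z \<in> D"
    and der: "(f has_derivative f') (at z)" and lin: "Vector_Spaces.linear (*s) (*s) f'"
    and det: "det (matrix f') \<noteq> 0"
  obtains g' where "(g has_derivative g') (at (f z))" "Vector_Spaces.linear (*s) (*s) g'"
    "\<And>v. f' (g' v) = v"
proof -
  obtain B where B: "matrix f' ** B = mat 1"
    using det by (auto simp: invertible_det_nz[symmetric] invertible_def)
  have right: "f' (B *v v) = v" for v
    using B by (simp add: matrix_works[OF lin, symmetric] matrix_vector_mul_assoc)
  have "(g has_derivative (*v) B) (at (f z))"
    by (rule has_derivative_inverse_strong[OF \<open>open D\<close> \<open>z \<in> D\<close> assms(2) gf der])
       (use right in auto)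
  then show thesis
    using matrix_vector_mul_linear_gen right by (rule that)
qed

section \<open>Osgood's theorem on injective holomorphic maps\<close>

text \<open>No case distinction on the Jacobian at \<open>p\<close> is made: for each
  \<open>v\<close> the equation \<open>Df p y = v\<close> is solved as a limit of equations at
  nearby points with nonzero Jacobian.\<close>

theorem injective_holomorphic_derivative_surj:
  fixes f :: "complex ^ 'n \<Rightarrow> complex ^ 'n"
  assumes "open D" and inj: "inj_on f D"
    and der: "\<And>z. z \<in> D \<Longrightarrow> (f has_derivative Df z) (at z)"
    and lin: "\<And>z. z \<in> D \<Longrightarrow> Vector_Spaces.linear (*s) (*s) (Df z)"
    and p: "p \<in> D"
  shows "surj (Df p)"
proof -
  have contf: "continuous_on D f"
    using der by (blast intro: has_derivative_continuous continuous_at_imp_continuous_on)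
  define g where "g = inv_into D f"
  have gf: "g (f x) = x" if "x \<in> D" for x
    using inj that by (simp add: g_def)
  have fg: "f (g w) = w" "g w \<in> D" if "w \<in> f ` D" for w
    using that by (auto simp: g_def f_inv_into_f inv_into_into)
  have "open (f ` D)"
    using contf \<open>open D\<close> inj by (rule invariance_of_domain)
  have contg: "continuous_on (f ` D) g"
    using \<open>open D\<close> contf gf by (intro continuous_on_inverse_open) auto
  have entries: "curve_holomorphic D (\<lambda>z. matrix (Df z) $ i $ j)" for i j
  proof -
    have "curve_holomorphic D (\<lambda>z. Df z (axis j 1) $ i)"
      using \<open>open D\<close>
    proof (rule directional_derivative_curve_holomorphic)
      show "((\<lambda>z. f z $ i) has_derivative (\<lambda>h. Df z h $ i)) (at z)" if "z \<in> D" for z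
        using der[OF that] by (rule bounded_linear.has_derivative[OF bounded_linear_vec_nth])
    qed (use lin in \<open>blast intro: linear_component\<close>)
    then show ?thesis by (simp add: matrix_def)
  qed
  define J where "J z = det (matrix (Df z))" for z
  have J: "curve_holomorphic D J"
    unfolding J_def using entries by (rule curve_holomorphic_det)
  \<comment> \<open>Away from the zeros of \<open>J\<close> the map \<open>g\<close> is holomorphic,
    and \<open>g' v\<close> is the solution of \<open>Df (g w) y = v\<close> whose size is
    controlled below.\<close>
  have derg: "\<exists>g'. (g has_derivative g') (at w) \<and> Vector_Spaces.linear (*s) (*s) g' \<and>
      (\<forall>v. Df (g w) (g' v) = v)" if w: "w \<in> f ` D" "J (g w) \<noteq> 0" for w
  proof -
    have *: "continuous_on D f" "g w \<in> D" "det (matrix (Df (g w))) \<noteq> 0"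
      using contf fg(2)[OF w(1)] w(2) by (auto simp: J_def)
    show ?thesis
      using has_derivative_inverse_holomorphic[OF \<open>open D\<close> *(1) gf *(2) der[OF *(2)] lin[OF *(2)] *(3)]
      unfolding fg(1)[OF w(1)] by blast
  qed
  define w0 where "w0 = f p"
  have w0: "w0 \<in> f ` D" "g w0 = p" using p gf by (auto simp: w0_def)
  obtain e where e: "0 < e" "cball w0 e \<subseteq> f ` D"
    using \<open>open (f ` D)\<close> w0(1) open_contains_cball by blast
  have "bounded (g ` cball w0 e)"
    using continuous_on_subset[OF contg e(2)] compact_cball
    by (intro compact_imp_bounded compact_continuous_image)
  then obtain M where M: "\<And>w. w \<in> cball w0 e \<Longrightarrow> norm (g w) \<le> M"
    unfolding bounded_iff by blast
  have "\<exists>y. Df p y = v" for v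
  proof -
    \<comment> \<open>The choice keeps \<open>w + t *s v\<close> in \<open>cball w0 e\<close>, where
      \<open>g\<close> is bounded by \<open>M\<close>, for all \<open>w\<close> within
      \<open>e / 2\<close> of \<open>w0\<close>.\<close>
    define \<rho> where "\<rho> = e / (2 * (norm v + 1))"
    have nv: "0 < norm v + 1" by (simp add: add_nonneg_pos)
    then have \<rho>: "0 < \<rho>" using e(1) by (simp add: \<rho>_def)
    have near: "w + t *s v \<in> cball w0 e" if "w \<in> ball w0 (e / 2)" "t \<in> cball 0 \<rho>" for w t
    proof -
      have "norm t * norm v \<le> \<rho> * (norm v + 1)"
        using that(2) \<rho> by (intro mult_mono) auto
      also have "\<dots> = e / 2" using nv unfolding \<rho>_def by (simp add: divide_simps)
      finally have "norm (t *s v) \<le> e / 2" by (simp add: norm_vector_scalar_mult)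
      moreover have "norm (w - w0) < e / 2"
        using that(1) by (simp add: dist_norm norm_minus_commute)
      ultimately have "norm (w - w0 + t *s v) \<le> e"
        by (smt (verit) norm_triangle_ineq field_sum_of_halves)
      then show ?thesis
        by (simp add: dist_norm norm_minus_commute[of w0] algebra_simps)
    qed
    \<comment> \<open>The bound does not depend on \<open>w\<close>: it holds on the circle of
      radius \<open>\<rho>\<close> for a difference quotient of a function bounded by
      \<open>M\<close>, and the maximum principle carries it to the centre.\<close>
    have bound: "norm (g' v $ i) \<le> 2 * M / \<rho>"
      if w: "w \<in> ball w0 (e / 2)" "J (g w) \<noteq> 0"
        and g': "(g has_derivative g') (at w)" "Vector_Spaces.linear (*s) (*s) g'" for w g' i
    proof -
      have [simp]: "w + 0 *s v = w" by (simp add: vec_eq_iff)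
      define \<gamma> where "\<gamma> t = g (w + t *s v)" for t
      define S where "S = {t \<in> ball 0 \<rho>. J (\<gamma> t) \<noteq> 0}"
      have img: "w + t *s v \<in> f ` D" if "t \<in> cball 0 \<rho>" for t
        using near[OF w(1) that] e(2) by blast
      have contl: "continuous_on (cball 0 \<rho>) (\<lambda>t. w + t *s v)"
        by (rule hol_maps_continuous_on[OF hol_maps_line])
      have cont\<gamma>: "continuous_on (cball 0 \<rho>) \<gamma>"
        unfolding \<gamma>_def by (rule continuous_on_compose2[OF contg contl]) (use img in auto)
      have contJ: "continuous_on (cball 0 \<rho>) (\<lambda>t. J (\<gamma> t))"
      proof (rule continuous_on_compose2[OF _ cont\<gamma>])
        show "continuous_on D J" using J by (simp add: curve_holomorphic_def)
        show "\<gamma> ` cball 0 \<rho> \<subseteq> D" using img fg(2) by (auto simp: \<gamma>_def)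
      qed
      have S_eq: "S = ball 0 \<rho> \<inter> (\<lambda>t. J (\<gamma> t)) -` (- {0})" by (auto simp: S_def)
      have "open S"
        unfolding S_eq using continuous_on_subset[OF contJ ball_subset_cball]
        by (intro continuous_open_preimage) auto
      have "0 \<in> S" using \<rho> w(2) by (simp add: S_def \<gamma>_def)
      have hol\<gamma>: "\<gamma> \<in> hol_maps (*) (*s) S D"
      proof -
        have "(\<lambda>t. w + t *s v) \<in> hol_maps (*) (*s) S {w \<in> f ` D. J (g w) \<noteq> 0}"
          by (rule hol_maps_mono[OF hol_maps_line order_refl]) (use img in \<open>auto simp: S_def \<gamma>_def\<close>)
        moreover have "g \<in> hol_maps (*s) (*s) {w \<in> f ` D. J (g w) \<noteq> 0} D"
          using derg fg(2) by (force simp: hol_maps_def)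
        ultimately have "g \<circ> (\<lambda>t. w + t *s v) \<in> hol_maps (*) (*s) S D"
          by (rule hol_maps_compose)
        then show ?thesis by (simp only: \<gamma>_def[abs_def] o_def)
      qed
      define \<phi> where "\<phi> = (\<lambda>t. \<gamma> t $ i)"
      have hol\<phi>: "\<phi> holomorphic_on S"
        using hol_maps_compose[OF hol\<gamma> hol_maps_mono[OF hol_maps_component[of i] order_refl subset_UNIV]]
          \<open>open S\<close> by (simp add: hol_maps_complex_iff \<phi>_def o_def)
      have "(\<phi> has_field_derivative g' v $ i) (at 0)"
        unfolding \<phi>_def \<gamma>_def
      proof (rule has_field_derivative_along_line)
        show "((\<lambda>w. g w $ i) has_derivative (\<lambda>h. g' h $ i)) (at (w + 0 *s v))"
          using g'(1) by (simp add: bounded_linear.has_derivative[OF bounded_linear_vec_nth])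
      qed (use g'(2) in \<open>rule linear_component\<close>)
      then have deriv: "deriv \<phi> 0 = g' v $ i" by (rule DERIV_imp_deriv)
      \<comment> \<open>The difference quotient at 0 of coordinate \<open>i\<close> of
        \<open>g\<close> along the line, with the removable singularity filled in. Holomorphy is
        available only on \<open>S\<close>, but continuity on the whole closed disc: on
        \<open>S\<close> by holomorphy, away from 0 by continuity of \<open>\<phi>\<close>.\<close>
      define h where "h = (\<lambda>t. if t = 0 then deriv \<phi> 0 else (\<phi> t - \<phi> 0) / (t - 0))"
      have holh: "h holomorphic_on S"
        unfolding h_def using hol\<phi> \<open>0 \<in> S\<close> \<open>open S\<close>
        by (intro pole_lemma) (auto simp: interior_open)
      have un: "S \<union> (cball 0 \<rho> - {0}) = cball 0 \<rho>"
        using \<open>0 \<in> S\<close> \<rho> by (auto simp: S_def)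
      have "continuous_on (cball 0 \<rho> - {0}) (\<lambda>t. (\<phi> t - \<phi> 0) / (t - 0))"
        unfolding \<phi>_def by (auto intro!: continuous_intros continuous_on_subset[OF cont\<gamma>])
      then have "continuous_on (cball 0 \<rho> - {0}) h"
        by (rule continuous_on_eq) (auto simp: h_def)
      moreover have "openin (top_of_set (cball 0 \<rho>)) S"
        using \<open>open S\<close> un by (intro open_subset) auto
      ultimately have "continuous_on (S \<union> (cball 0 \<rho> - {0})) h"
        using holh by (intro continuous_on_Un_local_open)
          (auto simp: un holomorphic_on_imp_continuous_on openin_delete)
      then have conth: "continuous_on (cball 0 \<rho>) h" by (simp only: un)
      have "norm (h 0) \<le> 2 * M / \<rho>"
      proof (rule maximum_modulus_off_zeros[OF conth contJ])
        show "h holomorphic_on {t \<in> ball 0 \<rho>. J (\<gamma> t) \<noteq> 0}"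
          using holh by (simp add: S_def)
        show "(\<lambda>t. J (\<gamma> t)) holomorphic_on {t \<in> ball 0 \<rho>. J (\<gamma> t) \<noteq> 0}"
          using J hol\<gamma> \<open>open S\<close> by (simp add: S_def curve_holomorphic_def)
        show "norm (h t) \<le> 2 * M / \<rho>" if t: "norm t = \<rho>" for t
        proof -
          have "norm (\<phi> s) \<le> M" if "s \<in> cball 0 \<rho>" for s
            unfolding \<phi>_def \<gamma>_def by (rule order_trans[OF Finite_Cartesian_Product.norm_nth_le M[OF near[OF w(1) that]]])
          from this[of t] this[of 0] have "norm (\<phi> t - \<phi> 0) \<le> 2 * M"
            using norm_triangle_ineq4[of "\<phi> t" "\<phi> 0"] t \<rho> by simp
          then show ?thesis
            using t \<rho> by (auto simp: h_def norm_divide divide_right_mono)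
        qed
        show "J (\<gamma> 0) \<noteq> 0" using w(2) by (simp add: \<gamma>_def)
      qed (rule \<rho>)
      then show ?thesis by (simp add: h_def deriv)
    qed
    \<comment> \<open>Otherwise \<open>Df\<close> would be singular on a whole neighbourhood
      \<open>U\<close> of \<open>p\<close>, against the injectivity of \<open>f\<close> by
      \<open>singular_derivative_not_injective\<close>.\<close>
    have dense: "\<exists>w. w \<in> ball w0 r \<and> J (g w) \<noteq> 0" if "0 < r" "r \<le> e" for r
    proof (rule ccontr)
      assume neg: "\<not> ?thesis"
      define U where "U = D \<inter> f -` ball w0 r"
      have "open U"
        unfolding U_def using contf \<open>open D\<close> by (intro continuous_open_preimage) auto
      have "p \<in> U" using p that by (simp add: U_def w0_def)
      have sing: "\<not> inj (Df x)" if "x \<in> U" for x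
      proof
        assume "inj (Df x)"
        have "x \<in> D" "f x \<in> ball w0 r" using that by (auto simp: U_def)
        have "(*v) (matrix (Df x)) = Df x"
          using matrix_works[OF lin[OF \<open>x \<in> D\<close>]] by auto
        then have "invertible (matrix (Df x))"
          using \<open>inj (Df x)\<close> by (simp add: invertible_left_inverse matrix_left_invertible_injective)
        then have "J (g (f x)) \<noteq> 0"
          using gf[OF \<open>x \<in> D\<close>] by (simp add: J_def invertible_det_nz)
        then show False using neg \<open>f x \<in> ball w0 r\<close> by blast
      qed
      have derU: "(f has_derivative Df x) (at x)" if "x \<in> U" for x
        using der that by (simp add: U_def)
      have "\<not> inj_on f U"
        using \<open>open U\<close> _ derU sing
        by (rule singular_derivative_not_injective) (use \<open>p \<in> U\<close> in blast)
      moreover have "inj_on f U"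
        using inj by (rule inj_on_subset) (auto simp: U_def)
      ultimately show False by blast
    qed
    \<comment> \<open>The radii shrink to 0, so that \<open>w\<close> tends to \<open>w0\<close>,
      and never exceed \<open>e / 2\<close>, so that \<open>bound\<close> applies; \<open>y\<close>
      is the derivative of \<open>g\<close> at \<open>w\<close> in direction
      \<open>v\<close>.\<close>
    have "\<exists>w y. w \<in> ball w0 (e / 2 / real (Suc k)) \<and> J (g w) \<noteq> 0 \<and> Df (g w) y = v \<and>
        (\<forall>i. norm (y $ i) \<le> 2 * M / \<rho>)" for k
    proof -
      have le: "e / 2 / real (Suc k) \<le> e / 2" using e(1) by (simp add: divide_le_eq)
      have "0 < e / 2 / real (Suc k)" using e(1) by simp
      moreover have "e / 2 / real (Suc k) \<le> e" using le e(1) by linarith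
      ultimately obtain w where w: "w \<in> ball w0 (e / 2 / real (Suc k))" "J (g w) \<noteq> 0"
        using dense by blast
      have w': "w \<in> ball w0 (e / 2)" using w(1) le by (meson subsetD subset_ball)
      then have "w \<in> cball w0 e" using e(1) by auto
      then have "w \<in> f ` D" using e(2) by blast
      from derg[OF this w(2)] show ?thesis
        using bound[OF w' w(2)] w by blast
    qed
    then obtain w y where w: "\<And>k. w k \<in> ball w0 (e / 2 / real (Suc k))"
      and Dy: "\<And>k. Df (g (w k)) (y k) = v" and y: "\<And>k i. norm (y k $ i) \<le> 2 * M / \<rho>"
      by metis
    have wball: "w k \<in> cball w0 e" for k
    proof -
      have "e / 2 / real (Suc k) \<le> e"
        using e(1) by (simp add: divide_le_eq)
      then show ?thesis using w[of k] by auto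
    qed
    have "w \<longlonglongrightarrow> w0"
    proof (rule metric_LIMSEQ_I)
      fix r :: real assume "0 < r"
      have "(\<lambda>k. e / 2 / real (Suc k)) \<longlonglongrightarrow> 0"
        by (rule LIMSEQ_Suc[OF lim_const_over_n])
      then have "\<forall>\<^sub>F k in sequentially. e / 2 / real (Suc k) < r"
        using \<open>0 < r\<close> by (rule order_tendstoD)
      then have "\<forall>\<^sub>F k in sequentially. dist (w k) w0 < r"
      proof (rule eventually_mono)
        fix k assume "e / 2 / real (Suc k) < r"
        then show "dist (w k) w0 < r"
          using w[of k] unfolding mem_ball dist_commute[of w0] by linarith
      qed
      then show "\<exists>n0. \<forall>n\<ge>n0. dist (w n) w0 < r"
        by (simp add: eventually_sequentially)
    qed
    moreover have "isCont g w0"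
      using contg \<open>open (f ` D)\<close> w0(1) continuous_on_eq_continuous_at by blast
    ultimately have gw: "(\<lambda>k. g (w k)) \<longlonglongrightarrow> p"
      using w0(2) isCont_tendsto_compose by metis
    have "bounded (range y)"
    proof (rule boundedI)
      fix x assume "x \<in> range y"
      then obtain k where x: "x = y k" by blast
      have "norm (y k) \<le> (\<Sum>i\<in>UNIV. norm (y k $ i))"
        unfolding norm_vec_def by (rule L2_set_le_sum) simp
      also have "\<dots> \<le> of_nat (card (UNIV :: 'n set)) * (2 * M / \<rho>)"
        by (rule sum_bounded_above) (rule y)
      finally show "norm x \<le> of_nat (card (UNIV :: 'n set)) * (2 * M / \<rho>)"
        unfolding x .
    qed
    then obtain l r where r: "strict_mono r" and l: "(y \<circ> r) \<longlonglongrightarrow> l"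
      using bounded_imp_convergent_subsequence by blast
    \<comment> \<open>The entries of the matrix of \<open>Df\<close> are continuous at
      \<open>p\<close>, so both factors of each product converge and the identity
      \<open>Df (g (w k)) (y k) = v\<close> passes to the limit along \<open>r\<close>.\<close>
    have "Df p l $ i = v $ i" for i
    proof -
      have *: "Df z x $ i = (\<Sum>j\<in>UNIV. matrix (Df z) $ i $ j * x $ j)" if "z \<in> D" for z x
        using matrix_works[OF lin[OF that], of x] by (simp add: matrix_vector_mult_def vec_eq_iff)
      have mat: "(\<lambda>k. matrix (Df (g (w (r k)))) $ i $ j) \<longlonglongrightarrow> matrix (Df p) $ i $ j" for j
      proof -
        have "isCont (\<lambda>z. matrix (Df z) $ i $ j) p"
          using entries[of i j] p \<open>open D\<close>
          by (simp add: curve_holomorphic_def continuous_on_eq_continuous_at)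
        then show ?thesis
          using LIMSEQ_subseq_LIMSEQ[OF gw r] isCont_tendsto_compose unfolding o_def by blast
      qed
      have "(\<lambda>k. \<Sum>j\<in>UNIV. matrix (Df (g (w (r k)))) $ i $ j * y (r k) $ j)
          \<longlonglongrightarrow> (\<Sum>j\<in>UNIV. matrix (Df p) $ i $ j * l $ j)"
        using tendsto_vec_nth[OF l[unfolded o_def]] by (intro tendsto_sum tendsto_mult mat)
      moreover have "(\<Sum>j\<in>UNIV. matrix (Df (g (w (r k)))) $ i $ j * y (r k) $ j) = v $ i" for k
        using *[of "g (w (r k))" "y (r k)"] fg(2) wball e(2) Dy by (metis subsetD)
      ultimately have "(\<lambda>k::nat. v $ i) \<longlonglongrightarrow> Df p l $ i"
        using *[OF p, of l] by simp
      then show ?thesis by (simp add: LIMSEQ_const_iff)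
    qed
    then show ?thesis by (auto simp: vec_eq_iff)
  qed
  then show ?thesis by (metis surj_def)
qed

text \<open>The derivative is a square matrix, so surjectivity makes it invertible, and the inverse
  is complex differentiable without exceptional points.\<close>

corollary inverse_of_injective_holomorphic:
  fixes f :: "complex ^ 'n \<Rightarrow> complex ^ 'n"
  assumes "open D" "f \<in> hol_maps (*s) (*s) D Y" and inj: "inj_on f D"
  shows "inv_into D f \<in> hol_maps (*s) (*s) (f ` D) D"
proof -
  obtain Df where Df: "\<And>z. z \<in> D \<Longrightarrow> (f has_derivative Df z) (at z)"
    "\<And>z. z \<in> D \<Longrightarrow> Vector_Spaces.linear (*s) (*s) (Df z)"
    using assms(2) unfolding hol_maps_def by (simp only: mem_Collect_eq) metis
  have "\<exists>g'. (inv_into D f has_derivative g') (at (f z)) \<and> Vector_Spaces.linear (*s) (*s) g'"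
    if z: "z \<in> D" for z
  proof -
    have "surj (Df z)"
      using assms(1) inj Df z by (rule injective_holomorphic_derivative_surj)
    moreover have "(*v) (matrix (Df z)) = Df z"
      using matrix_works[OF Df(2)[OF z]] by auto
    ultimately have "invertible (matrix (Df z))"
      by (simp add: invertible_right_inverse matrix_right_invertible_surjective)
    then show ?thesis
      using has_derivative_inverse_holomorphic[OF assms(1) hol_maps_continuous_on[OF assms(2)]
        inv_into_f_f[OF inj] z Df(1)[OF z] Df(2)[OF z]] by (metis invertible_det_nz)
  qed
  then show ?thesis
    by (auto simp: hol_maps_def inv_into_into)
qed

section \<open>The Poincare distance\<close>

lemma artanh_real_mono:
  assumes "0 \<le> x" "x \<le> y" "y < (1::real)"
  shows "artanh x \<le> artanh y"
proof -
  have "(1 + x) / (1 - x) \<le> (1 + y) / (1 - y)"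
    using assms by (intro frac_le) auto
  then show ?thesis
    using assms by (simp add: artanh_def)
qed

lemma tanh_artanh_real:
  assumes "0 \<le> x" "x < (1::real)"
  shows "tanh (artanh x) = x"
proof -
  have "exp (2 * artanh x) = (1 + x) / (1 - x)"
    using assms by (simp add: artanh_def)
  then have eq: "exp (- 2 * artanh x) = (1 - x) / (1 + x)"
    by (simp add: exp_minus)
  show ?thesis
    unfolding tanh_real_altdef eq using assms by (simp add: divide_simps)
qed

text \<open>The addition formula of \<open>tanh\<close> read backwards; it turns the estimate
  through the origin into the triangle inequality.\<close>

lemma artanh_real_add:
  assumes "0 \<le> x" "x < 1" "0 \<le> y" "y < (1::real)"
  shows "artanh ((x + y) / (1 + x * y)) = artanh x + artanh y"
proof -
  have "1 + x * y > 0" using assms by (simp add: add_pos_nonneg)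
  have "tanh (artanh x + artanh y) = (x + y) / (1 + x * y)"
    using assms by (simp add: tanh_add tanh_artanh_real)
  then show ?thesis by (metis artanh_tanh_real)
qed

text \<open>For \<open>norm a < 1\<close>, \<open>Moebius_function 0 a\<close> is the disc
  automorphism \<open>b \<mapsto> (b - a) / (1 - cnj a * b)\<close> taking \<open>a\<close> to 0;
  its first argument is a rotation angle.\<close>

definition pseudohyperbolic :: "complex \<Rightarrow> complex \<Rightarrow> real"
  where "pseudohyperbolic a b = norm (Moebius_function 0 a b)"

lemma Moebius_denominator_nonzero:
  assumes "norm a < 1" "norm b < 1"
  shows "1 - cnj a * b \<noteq> 0"
proof -
  have "norm (cnj a * b) < 1"
    using assms norm_mult_less[of "cnj a" 1 b 1] by simp
  then show ?thesis by force
qed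

lemma pseudohyperbolic_less_1:
  assumes "norm a < 1" "norm b < 1"
  shows "pseudohyperbolic a b < 1"
  unfolding pseudohyperbolic_def using assms by (rule Moebius_function_norm_lt_1)

lemma pseudohyperbolic_nonneg [simp]: "0 \<le> pseudohyperbolic a b"
  by (simp add: pseudohyperbolic_def)

lemma pseudohyperbolic_commute: "pseudohyperbolic a b = pseudohyperbolic b a"
proof -
  have "norm (1 - cnj a * b) = norm (cnj (1 - cnj a * b))"
    by (simp only: complex_mod_cnj)
  then show ?thesis
    by (simp add: pseudohyperbolic_def Moebius_function_simple norm_divide norm_minus_commute mult.commute)
qed

text \<open>The Moebius quotient of the two images is that of \<open>a\<close> and \<open>b\<close>
  times \<open>(1 - c * cnj a) / (1 - cnj c * a)\<close>, a quotient of complex conjugates and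
  therefore of modulus 1.\<close>

lemma pseudohyperbolic_Moebius:
  assumes "norm c < 1" "norm a < 1" "norm b < 1"
  shows "pseudohyperbolic (Moebius_function 0 c a) (Moebius_function 0 c b) = pseudohyperbolic a b"
proof -
  note nz = Moebius_denominator_nonzero
  have n: "1 - cnj c * a \<noteq> 0" "1 - cnj c * b \<noteq> 0" "1 - c * cnj a \<noteq> 0" "1 - cnj c * c \<noteq> 0"
    "1 - cnj a * b \<noteq> 0"
    using nz[of c a] nz[of c b] nz[of a c] nz[of c c] nz[of a b] assms by (auto simp: mult.commute)
  let ?A = "(a - c) / (1 - cnj c * a)" and ?B = "(b - c) / (1 - cnj c * b)"
  have "?B - ?A = (b - a) * (1 - cnj c * c) / ((1 - cnj c * a) * (1 - cnj c * b))"
    using n(1,2) by (simp add: divide_simps) (simp add: algebra_simps)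
  moreover have "1 - cnj ?A * ?B = (1 - cnj a * b) * (1 - cnj c * c) / ((1 - c * cnj a) * (1 - cnj c * b))"
    using n(2,3) by (simp add: divide_simps) (simp add: algebra_simps)
  ultimately have eq: "(?B - ?A) / (1 - cnj ?A * ?B)
      = (b - a) / (1 - cnj a * b) * ((1 - c * cnj a) / (1 - cnj c * a))"
    using n by (simp add: divide_simps)
  have "norm (1 - c * cnj a) = norm (1 - cnj c * a)"
    using complex_mod_cnj[of "1 - cnj c * a"] by simp
  then have "norm ((1 - c * cnj a) / (1 - cnj c * a)) = 1"
    using n(1) by (simp add: norm_divide)
  then show ?thesis
    unfolding pseudohyperbolic_def Moebius_function_simple eq norm_mult by simp
qed

text \<open>The triangle inequality through the origin, the only case in which it has to be
  computed.\<close>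

lemma pseudohyperbolic_le_add_norm:
  assumes "norm a < 1" "norm b < 1"
  shows "pseudohyperbolic a b \<le> (norm a + norm b) / (1 + norm a * norm b)"
proof -
  define A where "A = (norm a)\<^sup>2"
  define B where "B = (norm b)\<^sup>2"
  have sq: "(norm (b - a))\<^sup>2 = A + B - 2 * Re (cnj a * b)"
    "(norm (1 - cnj a * b))\<^sup>2 = 1 + A * B - 2 * Re (cnj a * b)"
    unfolding A_def B_def cmod_power2 by (simp_all add: power2_eq_square algebra_simps)
  have AB: "A < 1" "B < 1"
    using assms by (simp_all add: A_def B_def power_less_one_iff abs_square_less_1)
  have R: "- (norm a * norm b) \<le> Re (cnj a * b)"
    using abs_Re_le_cmod[of "cnj a * b"] by (simp add: norm_mult)
  have e1: "(norm a + norm b)\<^sup>2 = A + B + 2 * (norm a * norm b)"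
    "(1 + norm a * norm b)\<^sup>2 = 1 + A * B + 2 * (norm a * norm b)"
    by (simp_all add: A_def B_def power2_sum power_mult_distrib)
  \<comment> \<open>Twice this product is the difference of the two squares compared next.\<close>
  have "0 \<le> (1 - A) * (1 - B) * (Re (cnj a * b) + norm a * norm b)"
    using AB R by simp
  then have "(norm (b - a) * (1 + norm a * norm b))\<^sup>2 \<le> ((norm a + norm b) * norm (1 - cnj a * b))\<^sup>2"
    unfolding power_mult_distrib sq e1 by (simp add: algebra_simps)
  then have "norm (b - a) * (1 + norm a * norm b) \<le> (norm a + norm b) * norm (1 - cnj a * b)"
    by (rule power2_le_imp_le) simp
  moreover have "0 < norm (1 - cnj a * b)"
    using Moebius_denominator_nonzero[OF assms] by simp
  moreover have "0 < 1 + norm a * norm b"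
    by (simp add: add_pos_nonneg)
  ultimately show ?thesis
    by (simp add: pseudohyperbolic_def Moebius_function_simple norm_divide divide_simps)
qed

text \<open>Normalised so that \<open>poincare 0 b = artanh (norm b)\<close>, the quantity in
  \<open>caratheodory\<close> and \<open>lempert\<close>.\<close>

definition poincare :: "complex \<Rightarrow> complex \<Rightarrow> real"
  where "poincare a b = artanh (pseudohyperbolic a b)"

text \<open>A Moebius map takes the middle point \<open>b\<close> to 0 without changing any
  distance; there the estimate through the origin and the addition formula of \<open>artanh\<close>
  give the claim.\<close>

lemma poincare_triangle:
  assumes "norm a < 1" "norm b < 1" "norm c < 1"
  shows "poincare a c \<le> poincare a b + poincare b c"
proof -
  define A where "A = Moebius_function 0 b a"
  define C where "C = Moebius_function 0 b c"
  have n: "norm A < 1" "norm C < 1"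
    using assms by (simp_all add: A_def C_def Moebius_function_norm_lt_1)
  have le1: "norm A + norm C < 1 + norm A * norm C"
    using mult_pos_pos[of "1 - norm A" "1 - norm C"] n by (simp add: algebra_simps)
  have "pseudohyperbolic a c = pseudohyperbolic A C"
    unfolding A_def C_def using assms by (simp add: pseudohyperbolic_Moebius)
  then have "poincare a c \<le> artanh ((norm A + norm C) / (1 + norm A * norm C))"
    unfolding poincare_def using n le1 pseudohyperbolic_le_add_norm[OF n]
    by (intro artanh_real_mono) (auto simp: add_pos_nonneg divide_less_eq)
  also have "\<dots> = artanh (norm A) + artanh (norm C)"
    using n by (simp add: artanh_real_add)
  also have "\<dots> = poincare b a + poincare b c"
    by (simp add: poincare_def pseudohyperbolic_def A_def C_def)
  finally show ?thesis
    by (simp add: poincare_def pseudohyperbolic_commute)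
qed

lemma poincare_nonneg:
  assumes "norm a < 1" "norm b < 1"
  shows "0 \<le> poincare a b"
  using artanh_real_mono[of 0 "pseudohyperbolic a b"] pseudohyperbolic_less_1[OF assms]
  by (simp add: poincare_def)

text \<open>The Schwarz lemma after moving \<open>f 0\<close> to 0 by a Moebius map. The base point
  0 suffices because the discs in \<open>lempert\<close> send 0 to the first point.\<close>

lemma Schwarz_Pick_origin:
  assumes hol: "f holomorphic_on ball 0 1" and img: "\<And>z. norm z < 1 \<Longrightarrow> norm (f z) < 1"
    and "norm \<zeta> < 1"
  shows "poincare (f 0) (f \<zeta>) \<le> artanh (norm \<zeta>)"
proof -
  have n0: "norm (f 0) < 1" using img by simp
  have "Moebius_function 0 (f 0) holomorphic_on ball 0 1"
    using n0 by (rule Moebius_function_holomorphic)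
  then have "(Moebius_function 0 (f 0) \<circ> f) holomorphic_on ball 0 1"
    using hol img by (intro holomorphic_on_compose_gen[OF hol]) auto
  then have "norm ((Moebius_function 0 (f 0) \<circ> f) \<zeta>) \<le> norm \<zeta>"
  proof (rule Schwarz_Lemma)
    show "norm ((Moebius_function 0 (f 0) \<circ> f) z) < 1" if "norm z < 1" for z
      using img[OF that] n0 by (simp add: Moebius_function_norm_lt_1)
  qed (use assms(3) in \<open>simp_all add: Moebius_function_eq_zero\<close>)
  then show ?thesis
    unfolding poincare_def pseudohyperbolic_def using assms(3)
    by (intro artanh_real_mono) auto
qed

section \<open>Invariant distances, Fridman invariants and the squeezing function\<close>

text \<open>A competitor \<open>f\<close> on the left becomes the competitor \<open>d\<close>, the
  pullback of \<open>poincare\<close> along \<open>f\<close>, on the right; \<open>f z = 0\<close>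
  makes the two values at \<open>z\<close> and \<open>w\<close> equal.\<close>

lemma caratheodory_le_kobayashi:
  assumes "z \<in> D" "w \<in> D"
  shows "caratheodory D z w \<le> kobayashi D z w"
  unfolding caratheodory_def
proof (rule Sup_least)
  fix x assume "x \<in> {ereal (artanh (norm \<zeta>)) | f \<zeta>.
    f \<in> hol_maps (*s) (*) D unit_disc \<and> f z = 0 \<and> f w = \<zeta>}"
  then obtain f where x: "x = ereal (artanh (norm (f w)))" and f: "f \<in> hol_maps (*s) (*) D unit_disc"
    and "f z = 0"
    by blast
  have n: "norm (f y) < 1" if "y \<in> D" for y
    using f that by (auto simp: hol_maps_def)
  define d where "d a b = poincare (f a) (f b)" for a b
  have "pseudodistance_on D d"
    unfolding pseudodistance_on_def d_def
    using n poincare_nonneg poincare_triangle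
    by (auto simp: poincare_def pseudohyperbolic_commute)
       (auto simp: pseudohyperbolic_def Moebius_function_eq_zero)
  moreover have "ereal (d a b) \<le> lempert D a b" for a b
    unfolding lempert_def
  proof (rule Inf_greatest)
    fix l assume "l \<in> {ereal (artanh (norm \<zeta>)) | f \<zeta>. \<zeta> \<in> unit_disc \<and>
      f \<in> hol_maps (*) (*s) unit_disc D \<and> f 0 = a \<and> f \<zeta> = b}"
    then obtain \<phi> \<zeta> where l: "l = ereal (artanh (norm \<zeta>))" "\<zeta> \<in> unit_disc"
      and \<phi>: "\<phi> \<in> hol_maps (*) (*s) unit_disc D" "\<phi> 0 = a" "\<phi> \<zeta> = b"
      by blast
    have "f \<circ> \<phi> \<in> hol_maps (*) (*) unit_disc unit_disc"
      using \<phi>(1) f by (rule hol_maps_compose)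
    then have hol: "(f \<circ> \<phi>) holomorphic_on ball 0 1" and img: "(f \<circ> \<phi>) ` ball 0 1 \<subseteq> ball 0 1"
      by (simp_all add: hol_maps_complex_iff)
    have "poincare ((f \<circ> \<phi>) 0) ((f \<circ> \<phi>) \<zeta>) \<le> artanh (norm \<zeta>)"
    proof (rule Schwarz_Pick_origin)
      show "norm ((f \<circ> \<phi>) t) < 1" if "norm t < 1" for t
        using img that by (auto simp: image_subset_iff)
      show "(f \<circ> \<phi>) holomorphic_on ball 0 1" by (fact hol)
    qed (use l(2) in simp)
    then show "ereal (d a b) \<le> l"
      using \<phi> l by (simp add: d_def)
  qed
  moreover have "d z w = artanh (norm (f w))"
    using \<open>f z = 0\<close> by (simp add: d_def poincare_def pseudohyperbolic_def Moebius_function_simple)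
  ultimately show "x \<le> kobayashi D z w"
    unfolding kobayashi_def x by (intro Sup_upper) (auto intro: exI[of _ d])
qed

section \<open>Fridman invariants as suprema of radii\<close>

definition fridman_radii ::
  "(complex ^ 'n \<Rightarrow> complex ^ 'n \<Rightarrow> ereal) \<Rightarrow> (complex ^ 'n) set \<Rightarrow> complex ^ 'n \<Rightarrow> real set"
  where "fridman_radii d D z = {tanh r | r. r > 0 \<and>
      (\<exists>f \<in> hol_maps (*s) (*s) (unit_ball :: (complex ^ 'n) set) D.
         inj_on f unit_ball \<and> {w \<in> D. d z w < ereal r} \<subseteq> f ` unit_ball)}"

lemma fridman_eq_Sup_radii:
  "fridman d D z = (if fridman_radii d D z = {} then 0 else Sup (fridman_radii d D z))"
  unfolding fridman_def fridman_radii_def Let_def by (rule refl)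

text \<open>Values of \<open>tanh\<close> are below 1, so the supremum of a nonempty set of radii is
  meaningful on \<open>real\<close>; positivity yields \<open>fridman_nonneg\<close>.\<close>

lemma fridman_radii_bounds:
  assumes "x \<in> fridman_radii d D z"
  shows "0 < x" "x < 1"
  using assms by (auto simp: fridman_radii_def tanh_real_lt_1)

lemma radius_le_fridman:
  assumes "x \<in> fridman_radii d D z"
  shows "x \<le> fridman d D z"
proof -
  have "bdd_above (fridman_radii d D z)"
    by (rule bdd_aboveI[of _ 1]) (auto dest: fridman_radii_bounds)
  with assms have "x \<le> Sup (fridman_radii d D z)"
    by (rule cSup_upper)
  then show ?thesis
    using assms by (auto simp: fridman_eq_Sup_radii)
qed

lemma fridman_nonneg: "0 \<le> fridman d D z"
proof (cases "fridman_radii d D z = {}")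
  case True
  then show ?thesis by (simp add: fridman_eq_Sup_radii)
next
  case False
  then obtain x where "x \<in> fridman_radii d D z" by blast
  then show ?thesis
    using fridman_radii_bounds(1) radius_le_fridman by fastforce
qed

text \<open>Larger distances have smaller balls, so a map and a radius admissible for
  \<open>d\<close> stay admissible for \<open>d'\<close>. Nonnegativity covers the case in which
  \<open>d\<close> admits none.\<close>

lemma fridman_antimono:
  fixes D :: "(complex ^ 'n) set"
  assumes "\<And>w. w \<in> D \<Longrightarrow> d z w \<le> d' z w"
  shows "fridman d D z \<le> fridman d' D z"
proof (cases "fridman_radii d D z = {}")
  case True
  then show ?thesis by (simp add: fridman_eq_Sup_radii[of d] fridman_nonneg)
next
  case False
  have balls: "{w \<in> D. d' z w < ereal r} \<subseteq> {w \<in> D. d z w < ereal r}" for r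
    using assms by (auto intro: le_less_trans)
  have "x \<le> fridman d' D z" if x: "x \<in> fridman_radii d D z" for x
  proof (rule radius_le_fridman)
    obtain r f where r: "x = tanh r" "0 < r" and
      f: "f \<in> hol_maps (*s) (*s) (unit_ball :: (complex ^ 'n) set) D" "inj_on f unit_ball"
      "{w \<in> D. d z w < ereal r} \<subseteq> f ` unit_ball"
      using x unfolding fridman_radii_def by blast
    have "{w \<in> D. d' z w < ereal r} \<subseteq> f ` unit_ball"
      using balls f(3) by (rule order_trans)
    then show "x \<in> fridman_radii d' D z"
      unfolding fridman_radii_def using r f(1,2) by blast
  qed
  then have "Sup (fridman_radii d D z) \<le> fridman d' D z"
    using False by (intro cSup_least)
  then show ?thesis
    using False by (simp add: fridman_eq_Sup_radii[of d])
qed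

text \<open>Composing \<open>f\<close> with the linear functional dual to \<open>f w\<close> gives the competitor in \<open>caratheodory\<close>.\<close>

lemma artanh_norm_le_caratheodory:
  fixes f :: "complex ^ 'n \<Rightarrow> complex ^ 'n"
  assumes f: "f \<in> hol_maps (*s) (*s) D unit_ball" and "f z = 0" and "w \<in> D"
  shows "ereal (artanh (norm (f w))) \<le> caratheodory D z w"
proof -
  \<comment> \<open>The conjugate of \<open>f w\<close>, scaled to norm 1. If
    \<open>f w = 0\<close>, division by zero makes \<open>a = 0\<close>, and both
    \<open>L_le\<close> and the value of \<open>L\<close> at \<open>f w\<close> remain
    correct.\<close>
  define a where "a = (\<chi> i. cnj (f w $ i) / of_real (norm (f w)))"
  define L where "L = (\<lambda>x. \<Sum>i\<in>UNIV. a $ i * x $ i)"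
  have sq: "(\<Sum>i\<in>UNIV. (norm (x $ i))\<^sup>2) = (norm x)\<^sup>2" for x :: "complex ^ 'n"
    by (simp add: norm_vec_def L2_set_def sum_nonneg)
  have L_le: "norm (L x) \<le> norm x" for x
  proof -
    have "norm (L x) \<le> (\<Sum>i\<in>UNIV. \<bar>norm (a $ i)\<bar> * \<bar>norm (x $ i)\<bar>)"
      unfolding L_def using norm_sum by (rule order_trans) (simp add: norm_mult)
    also have "\<dots> \<le> L2_set (\<lambda>i. norm (a $ i)) UNIV * L2_set (\<lambda>i. norm (x $ i)) UNIV"
      by (rule L2_set_mult_ineq)
    also have "\<dots> = norm a * norm x" by (simp add: norm_vec_def)
    also have "norm a \<le> 1"
    proof -
      have "(norm a)\<^sup>2 = (\<Sum>i\<in>UNIV. (norm (a $ i))\<^sup>2)"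
        by (simp only: sq)
      also have "\<dots> = (\<Sum>i\<in>UNIV. (norm (f w $ i))\<^sup>2) / (norm (f w))\<^sup>2"
        by (simp add: a_def norm_divide power_divide sum_divide_distrib)
      also have "\<dots> \<le> 1" unfolding sq by simp
      finally show ?thesis using abs_square_le_1[of "norm a"] by simp
    qed
    finally show ?thesis by (simp add: mult_left_le_one_le mult_right_mono)
  qed
  have "L ` unit_ball \<subseteq> unit_disc"
    using le_less_trans[OF L_le] by force
  with hol_maps_functional[of a unit_ball, folded L_def] order_refl
  have "L \<in> hol_maps (*s) (*) unit_ball unit_disc"
    by (rule hol_maps_mono)
  from hol_maps_compose[OF f this]
  have "L \<circ> f \<in> hol_maps (*s) (*) D unit_disc" .
  moreover have "(L \<circ> f) z = 0"
    using \<open>f z = 0\<close> by (simp add: L_def)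
  moreover have "norm ((L \<circ> f) w) = norm (f w)"
  proof -
    have "L (f w) = (\<Sum>i\<in>UNIV. of_real ((norm (f w $ i))\<^sup>2)) / of_real (norm (f w))"
      by (simp add: L_def a_def sum_divide_distrib complex_norm_square[symmetric] mult.commute)
    also have "\<dots> = of_real ((norm (f w))\<^sup>2) / of_real (norm (f w))"
      by (simp only: of_real_sum[symmetric] sq)
    also have "\<dots> = of_real (norm (f w))"
      by (simp add: power2_eq_square)
    finally show ?thesis by simp
  qed
  ultimately have "ereal (artanh (norm (f w))) \<in> {ereal (artanh (norm \<zeta>)) | f \<zeta>.
      f \<in> hol_maps (*s) (*) D unit_disc \<and> f z = 0 \<and> f w = \<zeta>}"
    by (intro CollectI exI[of _ "L \<circ> f"] exI[of _ "(L \<circ> f) w"]) simp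
  then show ?thesis
    unfolding caratheodory_def by (rule Sup_upper)
qed

section \<open>Squeezing maps as competitors for the Fridman invariant\<close>

lemma le_fridman:
  fixes D :: "(complex ^ 'n) set"
  assumes "0 < r" "r < 1" "f \<in> hol_maps (*s) (*s) (unit_ball :: (complex ^ 'n) set) D" "inj_on f unit_ball"
    and "\<And>w. w \<in> D \<Longrightarrow> d z w < ereal (artanh r) \<Longrightarrow> w \<in> f ` unit_ball"
  shows "r \<le> fridman d D z"
proof -
  have tanh: "tanh (artanh r) = r" using assms by (simp add: tanh_artanh_real)
  then have "0 < artanh r" using assms(1) by (metis tanh_real_pos_iff)
  then have "tanh (artanh r) \<in> fridman_radii d D z"
    unfolding fridman_radii_def using assms(3-5) by blast
  then show ?thesis
    unfolding tanh by (rule radius_le_fridman)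
qed

lemma squeezing_map_le_fridman:
  fixes f :: "complex ^ 'n \<Rightarrow> complex ^ 'n"
  assumes "open D" and f: "f \<in> hol_maps (*s) (*s) D unit_ball" and "f z = 0" and inj: "inj_on f D"
    and r: "0 < r" "r < 1" "ball 0 r \<subseteq> f ` D"
  shows "r \<le> fridman (caratheodory D) D z"
proof -
  define G where "G = inv_into D f \<circ> (\<lambda>x. 0 + of_real r *s x)"
  have norm_r: "norm (complex_of_real r *s x) = r * norm x" for x :: "complex ^ 'n"
    using r(1) by (simp add: norm_vector_scalar_mult)
  have img: "complex_of_real r *s x \<in> f ` D" if "x \<in> unit_ball" for x :: "complex ^ 'n"
  proof -
    have "complex_of_real r *s x \<in> ball 0 r"
      using that r(1) norm_r[of x] by simp
    then show ?thesis using r(3) by blast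
  qed
  show ?thesis
    using r(1,2)
  proof (rule le_fridman)
    have "(\<lambda>x. 0 + complex_of_real r *s x) \<in> hol_maps (*s) (*s) unit_ball (f ` D)"
      by (rule hol_maps_mono[OF hol_maps_scale_translate order_refl]) (use img in auto)
    then show "G \<in> hol_maps (*s) (*s) unit_ball D"
      unfolding G_def using inverse_of_injective_holomorphic[OF \<open>open D\<close> f inj]
      by (rule hol_maps_compose)
    show "inj_on G unit_ball"
    proof (rule inj_onI)
      fix x y :: "complex ^ 'n" assume xy: "x \<in> unit_ball" "y \<in> unit_ball" "G x = G y"
      then have "inv_into D f (complex_of_real r *s x) = inv_into D f (complex_of_real r *s y)"
        by (simp add: G_def)
      then have "complex_of_real r *s x = complex_of_real r *s y"
        using img[OF xy(1)] img[OF xy(2)] by (rule inv_into_injective)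
      then show "x = y" using r(1) by (auto simp: vec_eq_iff)
    qed
    fix w assume w: "w \<in> D" and less: "caratheodory D z w < ereal (artanh r)"
    have "norm (f w) < 1" using f w by (auto simp: hol_maps_def)
    \<comment> \<open>If \<open>f w\<close> lay outside the ball of radius \<open>r\<close>, a
      linear functional of \<open>f\<close> would witness a Caratheodory distance of at least
      \<open>artanh r\<close>.\<close>
    have "norm (f w) < r"
    proof (rule ccontr)
      assume "\<not> norm (f w) < r"
      then have "artanh r \<le> artanh (norm (f w))"
        using r \<open>norm (f w) < 1\<close> by (intro artanh_real_mono) auto
      then have "ereal (artanh r) \<le> caratheodory D z w"
        using artanh_norm_le_caratheodory[OF f \<open>f z = 0\<close> w] by (meson ereal_less_eq(3) order_trans)
      then show False using less by simp
    qed
    \<comment> \<open>The preimage of \<open>w\<close> under \<open>G\<close>; it lies in the unit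
      ball because \<open>norm (f w) < r\<close>.\<close>
    define x where "x = complex_of_real (inverse r) *s f w"
    have eq: "complex_of_real r *s x = f w"
      using r(1) by (simp add: x_def vec_eq_iff)
    have "x \<in> unit_ball"
      using norm_r[of x] \<open>norm (f w) < r\<close> r(1) unfolding eq by simp
    moreover have "G x = w"
      using eq inj w by (simp add: G_def)
    ultimately show "w \<in> G ` unit_ball" by blast
  qed
qed

text \<open>This ensures that the set of radii in \<open>squeezing\<close> is nonempty, without
  which its \<open>Sup\<close> would be unspecified. The map is a biholomorphism onto
  \<open>E\<close> followed by an affine contraction.\<close>

lemma bounded_biholomorphic_squeezing_map:
  fixes D :: "(complex ^ 'n) set"
  assumes "open E" "bounded E" "biholomorphic D E" "z \<in> D"
  obtains f r where "0 < r" "f \<in> hol_maps (*s) (*s) D (unit_ball :: (complex ^ 'n) set)"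
    "f z = 0" "inj_on f D" "ball 0 r \<subseteq> f ` D"
proof -
  obtain F G where F: "F \<in> hol_maps (*s) (*s) D E" and G: "G \<in> hol_maps (*s) (*s) E D"
    and GF: "\<And>x. x \<in> D \<Longrightarrow> G (F x) = x" and FG: "\<And>y. y \<in> E \<Longrightarrow> F (G y) = y"
    using assms(3) unfolding biholomorphic_def by blast
  have "F z \<in> E" using F \<open>z \<in> D\<close> by (auto simp: hol_maps_def)
  then obtain e where e: "0 < e" "ball (F z) e \<subseteq> E"
    using assms(1) open_contains_ball by blast
  obtain N where N: "0 < N" "\<And>y. y \<in> E \<Longrightarrow> norm y \<le> N"
    using assms(2) by (auto simp: bounded_pos)
  \<comment> \<open>Points of \<open>E\<close> lie at distance at most \<open>2 * N\<close> from
    \<open>F z\<close>; the summand 1 puts the image into the open unit ball.\<close>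
  define c where "c = inverse (2 * N + 1)"
  have c: "0 < c" using N(1) by (simp add: c_def)
  define A where "A = (\<lambda>y. - (complex_of_real c *s F z) + complex_of_real c *s y)"
  have A: "A y = complex_of_real c *s (y - F z)" for y
    by (simp add: A_def vec_eq_iff algebra_simps)
  have normA: "norm (A y) = c * norm (y - F z)" for y
    unfolding A norm_vector_scalar_mult using c by simp
  have "A \<in> hol_maps (*s) (*s) E unit_ball"
    unfolding A_def
  proof (rule hol_maps_mono[OF hol_maps_scale_translate order_refl], unfold A_def[symmetric])
    have "norm (A y) < 1" if "y \<in> E" for y
    proof -
      have "norm (y - F z) < 2 * N + 1"
        using norm_triangle_ineq4[of y "F z"] N(2)[OF that] N(2)[OF \<open>F z \<in> E\<close>] by linarith
      then have "c * norm (y - F z) < c * (2 * N + 1)" using c by simp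
      then show ?thesis using N(1) by (simp add: normA c_def)
    qed
    then show "A ` E \<subseteq> unit_ball" by auto
  qed
  then have hol: "A \<circ> F \<in> hol_maps (*s) (*s) D unit_ball"
    using F by (intro hol_maps_compose)
  have z0: "(A \<circ> F) z = 0" by (simp add: A)
  have inj: "inj_on (A \<circ> F) D"
  proof (rule inj_onI)
    fix x y assume xy: "x \<in> D" "y \<in> D" "(A \<circ> F) x = (A \<circ> F) y"
    then have "F x = F y" using c by (simp add: A vec_eq_iff)
    then show "x = y" using GF xy(1,2) by metis
  qed
  have img: "ball 0 (c * e) \<subseteq> (A \<circ> F) ` D"
  proof
    fix x :: "complex ^ 'n" assume x: "x \<in> ball 0 (c * e)"
    define y where "y = F z + complex_of_real (inverse c) *s x"
    have "A y = x" using c by (simp add: A y_def vec_eq_iff)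
    have "norm (y - F z) < e"
      using normA[of y] x c \<open>A y = x\<close> by simp
    then have "y \<in> E" using e(2) by (auto simp: dist_norm norm_minus_commute)
    then have "x = (A \<circ> F) (G y)" "G y \<in> D"
      using FG \<open>A y = x\<close> G by (auto simp: hol_maps_def)
    then show "x \<in> (A \<circ> F) ` D" by blast
  qed
  show thesis
    by (rule that[OF _ hol z0 inj img]) (use c e(1) in simp)
qed

lemma squeezing_le_fridman:
  fixes D :: "(complex ^ 'n) set"
  assumes "open D" "z \<in> D"
  shows "squeezing D z \<le> fridman (caratheodory D) D z"
proof (cases "\<exists>E. is_domain E \<and> bounded E \<and> biholomorphic D E")
  case False
  show ?thesis
    unfolding squeezing_def if_not_P[OF False] by (rule fridman_nonneg)
next
  case True
  define S where "S = {r. r > 0 \<and> (\<exists>f \<in> hol_maps (*s) (*s) D (unit_ball :: (complex ^ 'n) set).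
    f z = 0 \<and> inj_on f D \<and> ball 0 r \<subseteq> f ` D)}"
  have "S \<noteq> {}"
  proof -
    obtain E where "open E" "bounded E" "biholomorphic D E"
      using True by (auto simp: is_domain_def)
    then obtain f r where "0 < r" "f \<in> hol_maps (*s) (*s) D (unit_ball :: (complex ^ 'n) set)"
        "f z = 0" "inj_on f D" "ball 0 r \<subseteq> f ` D"
      using \<open>z \<in> D\<close> by (rule bounded_biholomorphic_squeezing_map)
    then show ?thesis unfolding S_def by blast
  qed
  moreover have "r \<le> fridman (caratheodory D) D z" if "r \<in> S" for r
  proof (rule dense_le_bounded)
    obtain f where f: "0 < r" "f \<in> hol_maps (*s) (*s) D (unit_ball :: (complex ^ 'n) set)"
        "f z = 0" "inj_on f D" "ball 0 r \<subseteq> f ` D"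
      using \<open>r \<in> S\<close> unfolding S_def by blast
    have "ball 0 r \<subseteq> (unit_ball :: (complex ^ 'n) set)"
      using f(2,5) by (auto simp: hol_maps_def)
    then have "r \<le> 1" using f(1) by (simp add: ball_subset_ball_iff)
    show "0 < r" by (fact f)
    \<comment> \<open>The value \<open>r = 1\<close> is possible, for instance when \<open>D\<close>
      is the ball and \<open>z\<close> its centre, whereas \<open>squeezing_map_le_fridman\<close>
      requires a radius below 1. Hence the estimate is shown for all \<open>s < r\<close>.\<close>
    fix s assume s: "0 < s" "s < r"
    then have "ball 0 s \<subseteq> f ` D"
      using f(5) subset_ball[of s r 0] by auto
    then show "s \<le> fridman (caratheodory D) D z"
      using f s \<open>r \<le> 1\<close> \<open>open D\<close> by (intro squeezing_map_le_fridman[of D f]) auto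
  qed
  ultimately have "Sup S \<le> fridman (caratheodory D) D z"
    by (rule cSup_least)
  then show ?thesis
    using True by (simp only: squeezing_def S_def if_True)
qed

theorem proposition1:
  fixes D :: "(complex ^ 'n) set"
  assumes "is_domain D"
  shows "\<forall>z\<in>D. squeezing D z \<le> fridman (caratheodory D) D z \<and>
               fridman (caratheodory D) D z \<le> fridman (kobayashi D) D z"
proof (intro ballI conjI)
  fix z assume z: "z \<in> D"
  have "open D" using assms by (simp add: is_domain_def)
  then show "squeezing D z \<le> fridman (caratheodory D) D z"
    using z by (rule squeezing_le_fridman)
  show "fridman (caratheodory D) D z \<le> fridman (kobayashi D) D z"
    using caratheodory_le_kobayashi[OF z] by (rule fridman_antimono)
qed

end
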